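(* For every integer $n\geq 3$, the order complex of the poset $(P\!E_{n},\leq_{\mathrm{pchn}})$ with $\mathbf{0}$ and $\mathbf{1}$ removed is contractible.
   Context: Write $[n]=\{1,\dots,n\}$. A set partition $\mathbf{x}$ of $[n]$ is noncrossing if for all $1\leq i<j<k<l\leq n$, whenever $i,k$ lie in a common block and $j,l$ lie in a common block, then $i,j$ lie in a common block; write $i\sim_{\mathbf{x}}j$ if $i,j$ lie in the same block. $NC_{n}$ is the set of noncrossing set partitions of $[n]$, and $\leq_{\mathrm{dref}}$ (dual refinement) is defined by $\mathbf{x}\leq_{\mathrm{dref}}\mathbf{y}$ iff every block of $\mathbf{x}$ is contained in a block of $\mathbf{y}$; $\mathbf{0}$ is the partition into singletons and $\mathbf{1}$ is the one-block partition. For $n\geq 3$, $P\!E_{n}$ is the set of all $\mathbf{x}\in NC_{n}$ such that $\{n-1,n\}$ is not a block of $\mathbf{x}$, and it is not the case that both $1\sim_{\mathbf{x}}n-1$ and $\{n\}$ is a block of $\mathbf{x}$. Parking labeling: if $\mathbf{y}$ covers $\mathbf{x}$ in $(NC_{n},\leq_{\mathrm{dref}})$, there are unique blocks $B_{1},B_{2}$ of $\mathbf{x}$ with $B_{1}\cup B_{2}$ a block of $\mathbf{y}$; with $\min B_{1}<\min B_{2}$ put $\pi(\mathbf{x},\mathbf{y})=\max\{j\in B_{1}\mid j\leq i\text{ for all }i\in B_{2}\}$. Let $\mathscr{D}_{n}$ be the set of all maximal chains of $(NC_{n},\leq_{\mathrm{dref}})$ none of whose cover relations has label $\pi$ equal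 to $n-1$. The poset $(P\!E_{n},\leq_{\mathrm{pchn}})$ is the subposet of $(NC_{n},\leq_{\mathrm{dref}})$ whose maximal chains are precisely the members of $\mathscr{D}_{n}$: its ground set is the union of all chains in $\mathscr{D}_{n}$ (it is known that this is exactly $P\!E_{n}$), and $\leq_{\mathrm{pchn}}$ is the reflexive-transitive closure of the cover relations between consecutive elements of chains in $\mathscr{D}_{n}$. It is bounded by $\mathbf{0}$ and $\mathbf{1}$. The order complex of a poset is the simplicial complex whose faces are the chains of the poset. *)

theory Defs
  imports "HOL-Analysis.Analysis" "HOL-Library.Disjoint_Sets"
begin

section \<open>Order complexes and their geometric realization\<close>

definition order_complex :: "'a set \<Rightarrow> ('a \<Rightarrow> 'a \<Rightarrow> bool) \<Rightarrow> 'a set set" where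
  "order_complex P le = {C. finite C \<and> pred_on.chain P le C}"

text \<open>
  Points are given by barycentric coordinates: nonnegative weights on the vertices that sum to 1
  and whose support is a face.  The topology is that of pointwise convergence of the coordinates.
  For a finite complex, the only case needed here, it coincides with the usual (weak) topology.
  Whether the empty set is listed as a face is immaterial.  Note that \<open>contractible_space\<close> holds of
  the empty space, so contractibility in the usual sense also requires a nonempty realization.
\<close>
definition geometric_realization :: "'a set set \<Rightarrow> ('a \<Rightarrow> real) topology" where
  "geometric_realization K =
     subtopology (powertop_real UNIV)
       {f. (\<forall>v. 0 \<le> f v) \<and> {v. f v \<noteq> 0} \<in> K \<and> sum f {v. f v \<noteq> 0} = 1}"

section \<open>Noncrossing partitions\<close>

text \<open>A set partition is represented by its set of blocks.\<close>

definition same_block :: "nat set set \<Rightarrow> nat \<Rightarrow> nat \<Rightarrow> bool" where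
  "same_block x i j \<longleftrightarrow> (\<exists>B\<in>x. i \<in> B \<and> j \<in> B)"

definition NC :: "nat \<Rightarrow> nat set set set" where
  "NC n = {x. partition_on {1..n} x \<and>
     (\<forall>i j k l. 1 \<le> i \<and> i < j \<and> j < k \<and> k < l \<and> l \<le> n \<longrightarrow>
        same_block x i k \<longrightarrow> same_block x j l \<longrightarrow> same_block x i j)}"

definition dref :: "nat \<Rightarrow> nat set set \<Rightarrow> nat set set \<Rightarrow> bool" where
  "dref n = refines {1..n}"

definition singletons_partition :: "nat \<Rightarrow> nat set set" where
  "singletons_partition n = (\<lambda>i. {i}) ` {1..n}"

definition one_block_partition :: "nat \<Rightarrow> nat set set" where
  "one_block_partition n = {{1..n}}"

definition PE :: "nat \<Rightarrow> nat set set set" where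
  "PE n = {x \<in> NC n. {n - 1, n} \<notin> x \<and> \<not> (same_block x 1 (n - 1) \<and> {n} \<in> x)}"

section \<open>The parking labeling and the induced order\<close>

definition covers_on :: "'a set \<Rightarrow> ('a \<Rightarrow> 'a \<Rightarrow> bool) \<Rightarrow> 'a \<Rightarrow> 'a \<Rightarrow> bool" where
  "covers_on P le x y \<longleftrightarrow> x \<in> P \<and> y \<in> P \<and> x \<noteq> y \<and> le x y \<and>
     (\<forall>z\<in>P. le x z \<longrightarrow> le z y \<longrightarrow> z = x \<or> z = y)"

text \<open>
  Only meaningful when \<open>y\<close> covers \<open>x\<close> in the lattice of noncrossing partitions; then the pair
  \<open>B1, B2\<close> is unique.  The condition on the minima also forces \<open>B1 \<noteq> B2\<close>.
\<close>
definition parking_label :: "nat set set \<Rightarrow> nat set set \<Rightarrow> nat" where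
  "parking_label x y = (THE m. \<exists>B1\<in>x. \<exists>B2\<in>x. B1 \<union> B2 \<in> y \<and> Min B1 < Min B2 \<and>
     m = Max {j \<in> B1. \<forall>i\<in>B2. j \<le> i})"

text \<open>
  \<open>covers_on C (dref n)\<close> relates consecutive elements of the chain \<open>C\<close>; as \<open>C\<close> is maximal,
  these are the cover relations of \<open>NC n\<close> lying in \<open>C\<close>.
\<close>
definition parking_chains :: "nat \<Rightarrow> nat set set set set" where
  "parking_chains n = {C. pred_on.maxchain (NC n) (dref n) C \<and>
     (\<forall>x y. covers_on C (dref n) x y \<longrightarrow> parking_label x y \<noteq> n - 1)}"

definition pchn :: "nat \<Rightarrow> nat set set \<Rightarrow> nat set set \<Rightarrow> bool" where
  "pchn n = (\<lambda>x y. \<exists>C\<in>parking_chains n. covers_on C (dref n) x y)\<^sup>*\<^sup>*"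

end

theory Submission
  imports Defs
begin

text \<open>
  A cover of the lattice of noncrossing partitions has label \<open>n - 1\<close> iff it joins the singleton \<open>{n}\<close> to the
  block of \<open>n - 1\<close>.  Hence, on \<open>PE n\<close>, \<open>x\<close> is below \<open>y\<close> in the induced order iff \<open>x\<close> refines \<open>y\<close> and, in case
  \<open>{n}\<close> is a block of \<open>x\<close> and \<open>n - 1\<close>, \<open>n\<close> share a block \<open>B\<close> of \<open>y\<close>, the minimum of \<open>B\<close> is not in the
  \<open>x\<close>-block of \<open>n - 1\<close>.

  For \<open>n - 1 \<in> S \<subseteq> {2..n - 1}\<close> let \<open>p\<close> be the partition with \<open>S\<close> as its only possibly nontrivial block.  The
  open upper interval of \<open>p\<close> is shown to be nonevasive by induction on \<open>a = Min S\<close>; the theorem is the case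
  \<open>S = {n - 1}\<close>, in which \<open>p\<close> is the bottom element.  Let \<open>E\<close> be the partition with blocks \<open>{a..n - 1}\<close> and its
  complement.  The map \<open>e y = y \<sqinter> E\<close> satisfies \<open>e y \<le> y\<close> and \<open>e y \<le> E\<close>, so it contracts the
  interval, except where \<open>e y = p\<close>.  The exceptional \<open>y\<close> have the single block \<open>insert j S\<close> with
  \<open>2 \<le> j < a\<close>; they are minimal in the interval and their upper intervals are nonevasive by induction.
\<close>

section \<open>Collapses\<close>

text \<open>
  The empty set counts as a face, and \<open>\<sigma>\<close> may be empty: a single point then collapses to \<open>{}\<close>, which makes
  collapses of links and of complexes uniform.
\<close>
definition elem_collapse :: "'a set set \<Rightarrow> 'a set set \<Rightarrow> bool" where
  "elem_collapse K K' \<longleftrightarrow> (\<exists>\<sigma> w. w \<notin> \<sigma> \<and> \<sigma> \<in> K \<and> insert w \<sigma> \<in> K \<and>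
     (\<forall>\<rho>\<in>K. \<sigma> \<subseteq> \<rho> \<longrightarrow> \<rho> = \<sigma> \<or> \<rho> = insert w \<sigma>) \<and> K' = K - {\<sigma>, insert w \<sigma>})"

lemma continuous_map_Min_coords:
  fixes \<sigma> :: "'a set"
  assumes "finite \<sigma>" "\<sigma> \<noteq> {}" "\<And>v. v \<in> \<sigma> \<Longrightarrow> continuous_map X euclideanreal (\<lambda>x. f x v)"
  shows "continuous_map X euclideanreal (\<lambda>x. Min (f x ` \<sigma>))"
  using assms
proof (induction \<sigma> rule: finite_ne_induct)
  case (singleton x)
  then show ?case by simp
next
  case (insert a F)
  then show ?case by (simp add: continuous_map_real_min)
qed

text \<open>Mass \<open>m f\<close>, the least coordinate on \<open>\<sigma>\<close>, is moved at
  constant speed from each vertex of \<open>\<sigma>\<close> to \<open>w\<close>. At time 1 some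
  coordinate on \<open>\<sigma>\<close> is 0, so the point has left both removed faces. On the
  remaining faces \<open>m f = 0\<close>, so the motion is a deformation retraction.\<close>

lemma elem_collapse_homotopy_equivalent:
  fixes K :: "'a set set"
  assumes down: "\<And>\<rho> \<rho>'. \<rho> \<in> K \<Longrightarrow> \<rho>' \<subseteq> \<rho> \<Longrightarrow> \<rho>' \<in> K"
    and ne: "\<sigma> \<noteq> {}" and fin: "finite \<sigma>" and w: "w \<notin> \<sigma>" and \<tau>: "insert w \<sigma> \<in> K"
    and free: "\<And>\<rho>. \<rho> \<in> K \<Longrightarrow> \<sigma> \<subseteq> \<rho> \<Longrightarrow> \<rho> = \<sigma> \<or> \<rho> = insert w \<sigma>"
  shows "geometric_realization K homotopy_equivalent_space
         geometric_realization (K - {\<sigma>, insert w \<sigma>})"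
proof (rule deformation_retract_imp_homotopy_equivalent_space)
  let ?K' = "K - {\<sigma>, insert w \<sigma>}"
  define S where "S K = {f :: 'a \<Rightarrow> real. (\<forall>v. 0 \<le> f v) \<and> {v. f v \<noteq> 0} \<in> K \<and> sum f {v. f v \<noteq> 0} = 1}" for K
  have gr: "geometric_realization K = subtopology (powertop_real UNIV) (S K)" for K :: "'a set set"
    by (simp add: geometric_realization_def S_def)
  \<comment> \<open>The entries of \<open>c\<close> sum to 0 over \<open>insert w \<sigma>\<close>,
    so moving along \<open>c\<close> keeps the total mass 1.\<close>
  define c where "c v = (if v \<in> \<sigma> then 1 else if v = w then - real (card \<sigma>) else 0)" for v
  define m where "m f = Min (f ` \<sigma>)" for f :: "'a \<Rightarrow> real"
  \<comment> \<open>pushes the mass of the free face towards \<open>w\<close> until one coordinate of the face vanishes\<close>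
  define h where "h t f v = f v - t * m f * c v" for t f v
  have m_le: "m f \<le> f v" if "v \<in> \<sigma>" for f v
    using that fin by (simp add: m_def)
  have m_in: "\<exists>v\<in>\<sigma>. m f = f v" for f
  proof -
    have "m f \<in> f ` \<sigma>" unfolding m_def by (rule Min_in) (use fin ne in auto)
    then show ?thesis by blast
  qed
  have c_sum: "sum c (insert w \<sigma>) = 0"
  proof -
    have "sum c \<sigma> = real (card \<sigma>)" by (simp add: c_def)
    then show ?thesis using w fin by (simp add: c_def)
  qed
  \<comment> \<open>A positive minimum puts \<open>\<sigma>\<close> inside the support, and freeness
    leaves only the two removed faces.\<close>
  have m_pos: "({v. f v \<noteq> 0} = \<sigma> \<or> {v. f v \<noteq> 0} = insert w \<sigma>)" if f: "f \<in> S K" and m: "m f \<noteq> 0" for f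
  proof -
    have "0 < m f" using f m m_in[of f] by (auto simp: S_def less_le)
    then have "\<sigma> \<subseteq> {v. f v \<noteq> 0}" using m_le[of _ f] by force
    then show ?thesis using free f by (auto simp: S_def)
  qed
  have m0: "m f = 0" if "f \<in> S ?K'" for f
    using m_pos[of f] that by (auto simp: S_def)
  have h0: "h t f = f" if "m f = 0" for t f
    using that by (auto simp: h_def)
  have hK: "h t f \<in> S K" if t: "0 \<le> t" "t \<le> 1" and f: "f \<in> S K" for t f
  proof (cases "m f = 0")
    case True
    then show ?thesis using h0 f by simp
  next
    case False
    have nn: "\<And>v. 0 \<le> f v" using f by (auto simp: S_def)
    have mp: "0 < m f" using False nn m_in[of f] by (auto simp: less_le)
    have sup: "{v. f v \<noteq> 0} \<subseteq> insert w \<sigma>" using m_pos[OF f False] by auto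
    have nnh: "0 \<le> h t f v" for v
    proof (cases "v \<in> \<sigma>")
      case True
      have "t * m f \<le> m f" using t mp by (simp add: mult_left_le_one_le)
      also have "\<dots> \<le> f v" by (rule m_le[OF True])
      finally show ?thesis using True by (simp add: h_def c_def)
    next
      case False
      have "0 \<le> t * m f * real (card \<sigma>)" using t mp by simp
      then show ?thesis using nn[of v] False by (auto simp: h_def c_def)
    qed
    have suph: "{v. h t f v \<noteq> 0} \<subseteq> insert w \<sigma>"
      using sup by (auto simp: h_def c_def split: if_splits)
    have "sum (h t f) {v. h t f v \<noteq> 0} = sum (h t f) (insert w \<sigma>)"
      by (rule sum.mono_neutral_left) (use fin suph in auto)
    also have "\<dots> = sum f (insert w \<sigma>) - t * m f * sum c (insert w \<sigma>)"
      by (simp add: h_def sum_subtractf sum_distrib_left del: sum.insert)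
    also have "\<dots> = sum f (insert w \<sigma>)" using c_sum by simp
    also have "\<dots> = sum f {v. f v \<noteq> 0}"
      by (rule sum.mono_neutral_right) (use fin sup in auto)
    also have "\<dots> = 1" using f by (simp add: S_def)
    finally show ?thesis using nnh down[OF \<tau> suph] by (simp add: S_def)
  qed
  have h1: "h 1 f \<in> S ?K'" if f: "f \<in> S K" for f
  proof -
    obtain v where v: "v \<in> \<sigma>" "m f = f v" using m_in by blast
    then have "h 1 f v = 0" by (simp add: h_def c_def)
    then have "v \<notin> {v. h 1 f v \<noteq> 0}" by simp
    then have "{v. h 1 f v \<noteq> 0} \<noteq> \<sigma>" "{v. h 1 f v \<noteq> 0} \<noteq> insert w \<sigma>" using v by blast+
    then show ?thesis using hK[of 1 f] f by (simp add: S_def)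
  qed
  have coord: "continuous_map (subtopology (powertop_real UNIV) (S K)) euclideanreal (\<lambda>f. f v)" for v
    by (intro continuous_map_from_subtopology continuous_map_product_coordinates) simp
  have cont: "continuous_map (prod_topology (top_of_set {0..1}) (subtopology (powertop_real UNIV) (S K)))
      (powertop_real UNIV) (\<lambda>z. h (fst z) (snd z))"
  proof -
    let ?Z = "prod_topology (top_of_set {0..1::real}) (subtopology (powertop_real UNIV) (S K))"
    have 1: "continuous_map ?Z euclideanreal (\<lambda>z. snd z v)" for v
      using continuous_map_compose[OF continuous_map_snd coord] by (simp add: o_def)
    have 2: "continuous_map ?Z euclideanreal fst"
      using continuous_map_fst continuous_map_into_fulltopology by blast
    have 3: "continuous_map ?Z euclideanreal (\<lambda>z. m (snd z))"
      unfolding m_def by (rule continuous_map_Min_coords[OF fin ne 1])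
    show ?thesis
      unfolding continuous_map_componentwise_UNIV h_def
      by (intro allI continuous_intros 1 2 3)
  qed
  have cont1: "continuous_map (subtopology (powertop_real UNIV) (S K)) (powertop_real UNIV) (h 1)"
  proof -
    have "continuous_map (subtopology (powertop_real UNIV) (S K)) euclideanreal m"
      unfolding m_def by (rule continuous_map_Min_coords[OF fin ne coord])
    then show ?thesis
      unfolding continuous_map_componentwise_UNIV h_def
      by (intro allI continuous_intros coord)
  qed
  show "homotopic_with (\<lambda>x. True) (geometric_realization K) (geometric_realization K) (h 1) id"
    unfolding gr
  proof (subst homotopic_with_sym, subst homotopic_with, simp, intro exI conjI ballI)
    show "continuous_map (prod_topology (top_of_set {0..1}) (subtopology (powertop_real UNIV) (S K)))
        (subtopology (powertop_real UNIV) (S K)) (\<lambda>z. h (fst z) (snd z))"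
      using cont hK by (auto simp: continuous_map_in_subtopology)
  qed (auto simp: h_def)
  show "retraction_maps (geometric_realization K) (geometric_realization ?K') (h 1) id"
    unfolding retraction_maps_def gr
  proof (intro conjI ballI)
    show "continuous_map (subtopology (powertop_real UNIV) (S K)) (subtopology (powertop_real UNIV) (S ?K')) (h 1)"
      using cont1 h1 by (auto simp: continuous_map_in_subtopology)
    show "continuous_map (subtopology (powertop_real UNIV) (S ?K')) (subtopology (powertop_real UNIV) (S K)) id"
      by (auto simp: continuous_map_in_subtopology continuous_map_from_subtopology S_def)
  qed (use h0 m0 in auto)
qed

text \<open>A step with \<open>\<sigma>\<close> nonempty is a homotopy equivalence and keeps
  \<open>{}\<close> as a face. A step with \<open>\<sigma>\<close> empty can only occur at a single
  point, because \<open>{}\<close> is contained in every face.\<close>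

lemma collapsible_imp_contractible:
  fixes K :: "'a set set"
  assumes "elem_collapse\<^sup>*\<^sup>* K {}" "{} \<in> K" "\<And>\<rho>. \<rho> \<in> K \<Longrightarrow> finite \<rho>"
    "\<And>\<rho> \<rho>'. \<rho> \<in> K \<Longrightarrow> \<rho>' \<subseteq> \<rho> \<Longrightarrow> \<rho>' \<in> K"
  shows "topspace (geometric_realization K) \<noteq> {} \<and> contractible_space (geometric_realization K)"
  using assms
proof (induction rule: converse_rtranclp_induct)
  case base
  then show ?case by simp
next
  case (step K K')
  from step.hyps(1) obtain \<sigma> w where \<sigma>: "w \<notin> \<sigma>" "\<sigma> \<in> K" "insert w \<sigma> \<in> K"
     and free: "\<And>\<rho>. \<rho> \<in> K \<Longrightarrow> \<sigma> \<subseteq> \<rho> \<Longrightarrow> \<rho> = \<sigma> \<or> \<rho> = insert w \<sigma>" and K': "K' = K - {\<sigma>, insert w \<sigma>}"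
    unfolding elem_collapse_def by auto
  show ?case
  proof (cases "\<sigma> = {}")
    case True
    then have K: "K = {{}, {w}}" using \<sigma> free by auto
    have "{f :: 'a \<Rightarrow> real. (\<forall>v. 0 \<le> f v) \<and> {v. f v \<noteq> 0} \<in> K \<and> sum f {v. f v \<noteq> 0} = 1}
        = {\<lambda>v. if v = w then 1 else 0}" (is "?A = {?g}")
    proof
      show "?A \<subseteq> {?g}"
      proof
        fix f assume f: "f \<in> ?A"
        have "{v. f v \<noteq> 0} \<noteq> {}" 
        proof
          assume "{v. f v \<noteq> 0} = {}"
          then have "sum f {v. f v \<noteq> 0} = 0" by simp
          then show False using f by auto
        qed
        then have s: "{v. f v \<noteq> 0} = {w}" using f K by blast
        then have "f w = 1" using f by auto
        moreover have "f v = 0" if "v \<noteq> w" for v using s that by blast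
        ultimately show "f \<in> {?g}" by auto
      qed
      have "{v. ?g v \<noteq> 0} = {w}" by auto
      then show "{?g} \<subseteq> ?A" by (simp add: K)
    qed
    then show ?thesis unfolding geometric_realization_def by simp
  next
    case False
    have "finite \<sigma>" using \<sigma> step.prems by blast
    then have he: "geometric_realization K homotopy_equivalent_space geometric_realization K'"
      unfolding K' using elem_collapse_homotopy_equivalent[of K \<sigma> w] \<sigma> free False step.prems by blast
    have "topspace (geometric_realization K') \<noteq> {} \<and> contractible_space (geometric_realization K')"
    proof (rule step.IH)
      show "{} \<in> K'" using K' step.prems False by blast
      show "finite \<rho>" if "\<rho> \<in> K'" for \<rho> using that K' step.prems by blast
      show "\<rho>' \<in> K'" if "\<rho> \<in> K'" "\<rho>' \<subseteq> \<rho>" for \<rho> \<rho>'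
      proof -
        have "\<rho> \<in> K" using that K' by blast
        then have "\<not> \<sigma> \<subseteq> \<rho>" using free[of \<rho>] that(1) K' by blast
        then have "\<not> \<sigma> \<subseteq> \<rho>'" using that(2) by blast
        then show ?thesis using step.prems(3)[OF \<open>\<rho> \<in> K\<close> that(2)] K' by blast
      qed
    qed
    moreover have "topspace (geometric_realization K') \<subseteq> topspace (geometric_realization K)"
      by (auto simp: geometric_realization_def K')
    ultimately show ?thesis using homotopy_equivalent_space_contractibility[OF he] by blast
  qed
qed

section \<open>Nonevasive orders\<close>

text \<open>Nonevasiveness of the order complex, phrased on elements: the two recursive premises
  concern the deletion of \<open>v\<close> and its link, the latter being the order complex of the
  elements comparable to \<open>v\<close>.\<close>

inductive nonevasive :: "('a \<Rightarrow> 'a \<Rightarrow> bool) \<Rightarrow> 'a set \<Rightarrow> bool" for le where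
  point: "nonevasive le {a}"
| vertex: "v \<in> Q \<Longrightarrow> nonevasive le (Q - {v}) \<Longrightarrow>
    nonevasive le {y \<in> Q. y \<noteq> v \<and> (le y v \<or> le v y)} \<Longrightarrow> nonevasive le Q"

section \<open>From nonevasive orders to contractible order complexes\<close>

lemma mem_order_complex:
  "C \<in> order_complex P le \<longleftrightarrow> finite C \<and> C \<subseteq> P \<and> (\<forall>x\<in>C. \<forall>y\<in>C. x = y \<or> le x y \<or> le y x)"
  unfolding order_complex_def pred_on.chain_def by auto

text \<open>Here \<open>D\<close> stands for the deletion of \<open>v\<close> and \<open>L\<close>
  for its link. No face of \<open>D\<close> contains \<open>v\<close>, so a free face of
  \<open>L\<close> stays free after \<open>v\<close> is added to it.\<close>

lemma elem_collapse_cone: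
  assumes "elem_collapse L L'" "v \<notin> \<Union>D" "v \<notin> \<Union>L"
  shows "elem_collapse (D \<union> insert v ` L) (D \<union> insert v ` L')"
proof -
  from assms obtain \<sigma> w where \<sigma>: "w \<notin> \<sigma>" "\<sigma> \<in> L" "insert w \<sigma> \<in> L"
     and free: "\<And>\<rho>. \<rho> \<in> L \<Longrightarrow> \<sigma> \<subseteq> \<rho> \<Longrightarrow> \<rho> = \<sigma> \<or> \<rho> = insert w \<sigma>" and L': "L' = L - {\<sigma>, insert w \<sigma>}"
    unfolding elem_collapse_def by auto
  have inj: "\<rho> = \<rho>'" if "insert v \<rho> = insert v \<rho>'" "\<rho> \<in> L" "\<rho>' \<in> L" for \<rho> \<rho>'
    using that assms(3) by (metis Union_iff insert_ident)
  show ?thesis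
    unfolding elem_collapse_def
  proof (rule exI[of _ "insert v \<sigma>"], rule exI[of _ w], intro conjI ballI impI)
    show "w \<notin> insert v \<sigma>" using \<sigma> assms(3) by auto
    show "insert v \<sigma> \<in> D \<union> insert v ` L" using \<sigma> by auto
    show "insert w (insert v \<sigma>) \<in> D \<union> insert v ` L" using \<sigma> by (simp add: insert_commute)
    show "\<rho> = insert v \<sigma> \<or> \<rho> = insert w (insert v \<sigma>)"
      if \<rho>: "\<rho> \<in> D \<union> insert v ` L" and sub: "insert v \<sigma> \<subseteq> \<rho>" for \<rho>
    proof -
      have "\<rho> \<notin> D" using sub assms(2) by blast
      then obtain \<rho>' where \<rho>': "\<rho>' \<in> L" "\<rho> = insert v \<rho>'" using \<rho> by blast
      then have "\<sigma> \<subseteq> \<rho>'" using sub \<sigma> assms(3) by blast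
      then show ?thesis using free[OF \<rho>'(1)] \<rho>' by auto
    qed
    have "insert v ` (L - {\<sigma>, insert w \<sigma>}) = insert v ` L - insert v ` {\<sigma>, insert w \<sigma>}"
      by (rule inj_on_image_set_diff[of _ L]) (use inj \<sigma> in \<open>auto simp: inj_on_def\<close>)
    moreover have "D - insert v ` {\<sigma>, insert w \<sigma>} = D" using assms(2) by blast
    ultimately have "D \<union> insert v ` L' = (D \<union> insert v ` L) - insert v ` {\<sigma>, insert w \<sigma>}"
      by (simp add: L' Un_Diff)
    then show "D \<union> insert v ` L' = D \<union> insert v ` L - {insert v \<sigma>, insert w (insert v \<sigma>)}"
      by (simp add: insert_commute)
  qed
qed

lemma collapse_cone:
  assumes "elem_collapse\<^sup>*\<^sup>* L L'" "v \<notin> \<Union>D" "v \<notin> \<Union>L"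
  shows "elem_collapse\<^sup>*\<^sup>* (D \<union> insert v ` L) (D \<union> insert v ` L')"
  using assms
proof (induction rule: converse_rtranclp_induct)
  case (step L L1)
  have "L1 \<subseteq> L" using step.hyps(1) by (auto simp: elem_collapse_def)
  then have "elem_collapse\<^sup>*\<^sup>* (D \<union> insert v ` L1) (D \<union> insert v ` L')"
    by (intro step.IH step.prems(1)) (use step.prems(2) in blast)
  with elem_collapse_cone[OF step.hyps(1) step.prems] show ?case
    by (rule converse_rtranclp_into_rtranclp[of elem_collapse])
qed simp

text \<open>The faces are those of the deletion \<open>?D\<close> and \<open>insert v \<rho>\<close>
  for \<open>\<rho>\<close> in the link \<open>?L\<close>. Collapsing the link, its empty face
  included, removes every face through \<open>v\<close>, among them \<open>{v}\<close>; the deletion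
  then collapses by induction.\<close>

lemma nonevasive_collapsible:
  assumes "nonevasive le Q"
  shows "elem_collapse\<^sup>*\<^sup>* (order_complex Q le) {}"
  using assms
proof induction
  case (point a)
  have eq: "order_complex {a} le = {{}, {a}}"
    by (auto simp: mem_order_complex subset_singleton_iff)
  have "elem_collapse (order_complex {a} le) {}"
    unfolding eq elem_collapse_def by (rule exI[of _ "{}"], rule exI[of _ a]) simp
  then show ?case by (rule r_into_rtranclp[of elem_collapse])
next
  case (vertex v Q)
  let ?D = "order_complex (Q - {v}) le" and ?L = "order_complex {y \<in> Q. y \<noteq> v \<and> (le y v \<or> le v y)} le"
  have eq: "order_complex Q le = ?D \<union> insert v ` ?L"
  proof (intro equalityI subsetI)
    fix C assume C: "C \<in> order_complex Q le"
    show "C \<in> ?D \<union> insert v ` ?L"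
    proof (cases "v \<in> C")
      case True
      have "C - {v} \<in> ?L"
        using C True by (auto simp: mem_order_complex)
      moreover have "C = insert v (C - {v})" using True by blast
      ultimately show ?thesis by (intro UnI2 image_eqI)
    next
      case False
      then have "C \<in> ?D" using C by (simp add: mem_order_complex subset_Diff_insert)
      then show ?thesis by (rule UnI1)
    qed
  next
    fix C assume "C \<in> ?D \<union> insert v ` ?L"
    then consider "C \<in> ?D" | C' where "C = insert v C'" "C' \<in> ?L" by blast
    then show "C \<in> order_complex Q le"
    proof cases
      case 1
      then show ?thesis by (simp add: mem_order_complex subset_Diff_insert)
    next
      case 2
      have C': "finite C'" "C' \<subseteq> {y \<in> Q. y \<noteq> v \<and> (le y v \<or> le v y)}"
          "\<forall>x\<in>C'. \<forall>y\<in>C'. x = y \<or> le x y \<or> le y x"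
        using 2(2) by (simp_all add: mem_order_complex)
      have "finite C" "C \<subseteq> Q" using C'(1,2) 2(1) vertex.hyps(1) by auto
      moreover have "x = y \<or> le x y \<or> le y x" if "x \<in> C" "y \<in> C" for x y
        using that C'(2,3) unfolding 2(1) by (elim insertE) (simp, blast, blast, simp)
      ultimately show ?thesis by (simp add: mem_order_complex)
    qed
  qed
  have "elem_collapse\<^sup>*\<^sup>* (?D \<union> insert v ` ?L) (?D \<union> insert v ` {})"
    by (rule collapse_cone[OF vertex.IH(2)]) (auto simp: mem_order_complex)
  then show ?case using vertex.IH(1) eq by simp
qed

lemma nonevasive_contractible:
  assumes "nonevasive le Q"
  shows "topspace (geometric_realization (order_complex Q le)) \<noteq> {} \<and>
    contractible_space (geometric_realization (order_complex Q le))"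
  by (rule collapsible_imp_contractible[OF nonevasive_collapsible[OF assms]])
     (auto simp: mem_order_complex intro: finite_subset)

section \<open>Criteria for nonevasiveness\<close>

text \<open>Any \<open>v\<close> other than the apex \<open>a\<close> can be removed: its deletion
  and its link are smaller and both still contain \<open>a\<close>.\<close>

lemma nonevasive_cone:
  assumes "finite Q" "a \<in> Q" "\<And>y. y \<in> Q \<Longrightarrow> le y a \<or> le a y"
  shows "nonevasive le Q"
  using assms
proof (induction "card Q" arbitrary: Q rule: less_induct)
  case less
  show ?case
  proof (cases "Q = {a}")
    case True
    then show ?thesis by (simp add: nonevasive.point)
  next
    case False
    then obtain v where v: "v \<in> Q" "v \<noteq> a" using less.prems by blast
    have sub: "{y \<in> Q. y \<noteq> v \<and> (le y v \<or> le v y)} \<subset> Q" using v by auto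
    show ?thesis
    proof (rule nonevasive.vertex[OF v(1)])
      show "nonevasive le (Q - {v})"
        by (rule less.hyps) (use v less.prems card_Diff1_less[OF less.prems(1) v(1)] in auto)
      show "nonevasive le {y \<in> Q. y \<noteq> v \<and> (le y v \<or> le v y)}"
      proof (rule less.hyps)
        show "card {y \<in> Q. y \<noteq> v \<and> (le y v \<or> le v y)} < card Q"
          by (rule psubset_card_mono[OF less.prems(1) sub])
      qed (use v less.prems in auto)
    qed
  qed
qed

text \<open>Combinatorial form of the contraction along \<open>y \<ge> e y \<le> E\<close>. A
  minimal \<open>y\<close> among the elements moved by \<open>e\<close> is removed: everything
  strictly below it is fixed by \<open>e\<close>, hence lies below \<open>e y\<close>, so the link
  of \<open>y\<close> is a cone with apex \<open>e y\<close>. Once \<open>e\<close> moves nothing,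
  \<open>E\<close> is the greatest element.\<close>

lemma nonevasive_conical:
  assumes "finite Q" "E \<in> Q"
    and refl: "\<And>x. x \<in> Q \<Longrightarrow> le x x"
    and trans: "\<And>x y z. le x y \<Longrightarrow> le y z \<Longrightarrow> le x z"
    and antisym: "\<And>x y. le x y \<Longrightarrow> le y x \<Longrightarrow> x = y"
    and "\<And>y. y \<in> Q \<Longrightarrow> e y \<in> Q" "\<And>y. y \<in> Q \<Longrightarrow> le (e y) y" "\<And>y. y \<in> Q \<Longrightarrow> le (e y) E"
    and "\<And>x y. x \<in> Q \<Longrightarrow> y \<in> Q \<Longrightarrow> le x y \<Longrightarrow> le (e x) (e y)"
  shows "nonevasive le Q"
  using assms(1,2,3,6-)
proof (induction "card Q" arbitrary: Q E e rule: less_induct)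
  case less
  note fin = less.prems(1) and E = less.prems(2) and rf = less.prems(3) and eQ = less.prems(4)
    and e_le = less.prems(5) and e_E = less.prems(6) and e_mono = less.prems(7)
  show ?case
  proof (cases "\<forall>y\<in>Q. e y = y")
    case True
    then show ?thesis using e_E by (intro nonevasive_cone[OF fin E]) force
  next
    case False
    define W where "W = {y \<in> Q. e y \<noteq> y}"
    define lt where "lt x y \<longleftrightarrow> le x y \<and> x \<noteq> y" for x y
    have "finite W" "W \<noteq> {}" using fin False by (auto simp: W_def)
    moreover have "transp_on W lt" "asymp_on W lt"
    proof -
      show "transp_on W lt"
        unfolding lt_def by (intro transp_onI) (auto dest: trans antisym)
      show "asymp_on W lt"
        unfolding lt_def by (intro asymp_onI) (auto dest: antisym)
    qed
    ultimately obtain y where y: "y \<in> W" "\<And>z. z \<in> W \<Longrightarrow> \<not> lt z y"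
      using Finite_Set.bex_min_element[of W lt] by (metis asymp_onD)
    have yQ: "y \<in> Q" "e y \<noteq> y" using y by (auto simp: W_def)
    have below: "le z (e y)" if "z \<in> Q" "le z y" "z \<noteq> y" for z
    proof -
      have "e z = z" using y(2)[of z] that by (auto simp: W_def lt_def)
      then show ?thesis using e_mono[OF that(1) yQ(1) that(2)] by simp
    qed
    \<comment> \<open>Composing \<open>e\<close> with \<open>r\<close> restores the hypotheses on
      \<open>Q - {y}\<close>. The bound becomes \<open>r E\<close>, since \<open>E\<close> may be
      \<open>y\<close> itself.\<close>
    define r where "r z = (if z = y then e y else z)" for z
    have r_mono: "le (r z) (r z')" if "z \<in> Q" "z' \<in> Q" "le z z'" for z z'
    proof (cases "z' = y")
      case True
      then show ?thesis using that below rf eQ[OF yQ(1)] by (auto simp: r_def)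
    next
      case False
      then show ?thesis using that trans[OF e_le[OF yQ(1)], of z'] by (auto simp: r_def)
    qed
    have rQ: "r z \<in> Q - {y}" if "z \<in> Q" for z
      using that eQ[OF yQ(1)] yQ by (auto simp: r_def)
    have r_le: "le (r z) z" if "z \<in> Q" for z
      using that rf e_le by (auto simp: r_def)
    show ?thesis
    proof (rule nonevasive.vertex[OF yQ(1)])
      show "nonevasive le {z \<in> Q. z \<noteq> y \<and> (le z y \<or> le y z)}"
      proof (rule nonevasive_cone[of _ "e y"])
        show "le z (e y) \<or> le (e y) z" if "z \<in> {z \<in> Q. z \<noteq> y \<and> (le z y \<or> le y z)}" for z
          using that below[of z] trans[OF e_le[OF yQ(1)], of z] by auto
      qed (use fin eQ e_le yQ in auto)
      show "nonevasive le (Q - {y})"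
      proof (rule less.hyps[of _ "r E" "\<lambda>z. r (e z)"])
        show "card (Q - {y}) < card Q" using fin yQ by (intro card_Diff1_less)
        show "le (r (e z)) z" if "z \<in> Q - {y}" for z
          by (rule trans[OF r_le[OF eQ] e_le]) (use that in auto)
        show "le (r (e z)) (r E)" if "z \<in> Q - {y}" for z
          by (rule r_mono[OF eQ E]) (use that e_E in auto)
      qed (use fin E rQ rf eQ e_mono r_mono in auto)
    qed
  qed
qed

text \<open>The link of a minimal element is its strict upper interval. Elements of \<open>M\<close>
  are pairwise incomparable, so removing some of them leaves the upper intervals of the others
  unchanged, and they can be adjoined one at a time.\<close>

lemma nonevasive_add_minimal:
  assumes "finite M" "M \<subseteq> Q" "nonevasive le (Q - M)"
    and min: "\<And>b y. b \<in> M \<Longrightarrow> y \<in> Q \<Longrightarrow> le y b \<Longrightarrow> y = b"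
    and "\<And>b. b \<in> M \<Longrightarrow> nonevasive le {y \<in> Q. le b y \<and> y \<noteq> b}"
  shows "nonevasive le Q"
  using assms
proof (induction M arbitrary: Q rule: finite_induct)
  case empty
  then show ?case by simp
next
  case (insert b M)
  have up: "{y \<in> Q - {b}. le c y \<and> y \<noteq> c} = {y \<in> Q. le c y \<and> y \<noteq> c}" if "c \<in> M" for c
    using that insert.prems insert.hyps by auto
  have "nonevasive le (Q - {b})"
  proof (rule insert.IH)
    show "M \<subseteq> Q - {b}" using insert.prems insert.hyps by auto
    show "nonevasive le (Q - {b} - M)" using insert.prems(2) by (simp add: Diff_insert[symmetric] Diff_insert2[symmetric])
    show "nonevasive le {y \<in> Q - {b}. le c y \<and> y \<noteq> c}" if "c \<in> M" for c
      using up[OF that] insert.prems(4)[of c] that by simp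
  qed (use insert.prems in auto)
  moreover have "{y \<in> Q. y \<noteq> b \<and> (le y b \<or> le b y)} = {y \<in> Q. le b y \<and> y \<noteq> b}"
    using insert.prems(3) by auto
  ultimately show ?case
    using nonevasive.vertex[of b Q le] insert.prems(1,4) by auto
qed

section \<open>Noncrossing partitions as equivalence relations\<close>

lemma same_block_sym: "same_block x i j \<Longrightarrow> same_block x j i"
  by (auto simp: same_block_def)

lemma NC_partition_on: "x \<in> NC n \<Longrightarrow> partition_on {1..n} x"
  by (simp add: NC_def)

lemma same_block_range:
  assumes "x \<in> NC n" "same_block x i j"
  shows "1 \<le> i" "i \<le> n" "1 \<le> j" "j \<le> n"
  using NC_partition_on[OF assms(1)] assms(2) by (auto simp: same_block_def partition_on_def)

lemma same_block_refl:
  assumes "x \<in> NC n" "1 \<le> i" "i \<le> n"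
  shows "same_block x i i"
proof -
  have "i \<in> \<Union>x" using NC_partition_on[OF assms(1)] assms(2,3) by (simp add: partition_on_def)
  then show ?thesis by (auto simp: same_block_def)
qed

lemma same_block_trans:
  assumes "x \<in> NC n" "same_block x i j" "same_block x j k"
  shows "same_block x i k"
proof -
  obtain B B' where B: "B \<in> x" "i \<in> B" "j \<in> B" "B' \<in> x" "j \<in> B'" "k \<in> B'"
    using assms(2,3) by (auto simp: same_block_def)
  have "disjoint x" using NC_partition_on[OF assms(1)] by (simp add: partition_on_def)
  then have "B = B'" using B disjointD[of x B B'] by blast
  then show ?thesis using B by (auto simp: same_block_def)
qed

lemma noncrossing:
  assumes "x \<in> NC n" "i < j" "j < k" "k < l" "same_block x i k" "same_block x j l"
  shows "same_block x i j"
proof -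
  have "1 \<le> i" "l \<le> n" using same_block_range[OF assms(1)] assms(5,6) by blast+
  then show ?thesis using assms unfolding NC_def by blast
qed

lemma block_eq:
  assumes x: "x \<in> NC n" and B: "B \<in> x" "a \<in> B"
  shows "B = {j. same_block x a j}"
proof (rule set_eqI)
  fix j
  have "disjoint x" using NC_partition_on[OF x] by (simp add: partition_on_def)
  then have uniq: "B' = B" if "B' \<in> x" "a \<in> B'" for B'
    using that B disjointD[of x B' B] by blast
  have "j \<in> B" if aj: "same_block x a j"
  proof -
    obtain B' where "B' \<in> x" "a \<in> B'" "j \<in> B'" using aj unfolding same_block_def by blast
    then show ?thesis using uniq[of B'] by simp
  qed
  moreover have "same_block x a j" if "j \<in> B"
    unfolding same_block_def using B that by blast
  ultimately show "j \<in> B \<longleftrightarrow> j \<in> {j. same_block x a j}" by auto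
qed

lemma mem_NC_iff:
  assumes x: "x \<in> NC n" and a: "a \<in> B"
  shows "B \<in> x \<longleftrightarrow> 1 \<le> a \<and> a \<le> n \<and> B = {j. same_block x a j}"
proof
  assume B: "B \<in> x"
  have "same_block x a a" using B a by (auto simp: same_block_def)
  then show "1 \<le> a \<and> a \<le> n \<and> B = {j. same_block x a j}"
    using same_block_range[OF x] block_eq[OF x B a] by simp
next
  assume r: "1 \<le> a \<and> a \<le> n \<and> B = {j. same_block x a j}"
  then have "same_block x a a" using same_block_refl[OF x] by simp
  then obtain B' where B': "B' \<in> x" "a \<in> B'" by (auto simp: same_block_def)
  then show "B \<in> x" using block_eq[OF x B'] r by simp
qed

lemma same_block_mono:
  assumes "dref n x y" "same_block x i j"
  shows "same_block y i j"
proof -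
  obtain B where B: "B \<in> x" "i \<in> B" "j \<in> B" using assms(2) unfolding same_block_def by blast
  have "\<forall>X\<in>x. \<exists>Y\<in>y. X \<subseteq> Y" using assms(1) by (simp add: dref_def refines_def)
  then obtain Y where "Y \<in> y" "B \<subseteq> Y" using B(1) by blast
  then show ?thesis unfolding same_block_def using B(2,3) by blast
qed

lemma dref_iff:
  assumes x: "x \<in> NC n" and y: "y \<in> NC n"
  shows "dref n x y \<longleftrightarrow> (\<forall>i j. same_block x i j \<longrightarrow> same_block y i j)"
proof
  assume "dref n x y"
  then show "\<forall>i j. same_block x i j \<longrightarrow> same_block y i j"
    using same_block_mono by blast
next
  assume sub: "\<forall>i j. same_block x i j \<longrightarrow> same_block y i j"
  have "\<exists>Y\<in>y. B \<subseteq> Y" if B: "B \<in> x" for B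
  proof -
    have "B \<noteq> {}" using B NC_partition_on[OF x] by (auto simp: partition_on_def)
    then obtain a where a: "a \<in> B" by blast
    have Ba: "1 \<le> a" "a \<le> n" "B = {j. same_block x a j}" using mem_NC_iff[OF x a] B by blast+
    have "{j. same_block y a j} \<in> y"
      using mem_NC_iff[OF y, of a "{j. same_block y a j}"] same_block_refl[OF y Ba(1,2)] Ba(1,2) by simp
    then show ?thesis using sub Ba(3) by blast
  qed
  then show "dref n x y"
    using NC_partition_on[OF x] NC_partition_on[OF y] by (simp add: dref_def refines_def)
qed

lemma dref_refl: "x \<in> NC n \<Longrightarrow> dref n x x"
  by (simp add: dref_iff)

lemma dref_trans: "dref n x y \<Longrightarrow> dref n y z \<Longrightarrow> dref n x z"
  unfolding dref_def by (rule refines_trans)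

lemma dref_antisym: "dref n x y \<Longrightarrow> dref n y x \<Longrightarrow> x = y"
  unfolding dref_def by (rule refines_asym)

lemma NC_eqI:
  assumes "x \<in> NC n" "y \<in> NC n" "\<And>i j. same_block x i j \<longleftrightarrow> same_block y i j"
  shows "x = y"
proof (rule dref_antisym[of n])
  show "dref n x y" unfolding dref_iff[OF assms(1,2)] using assms(3) by blast
  show "dref n y x" unfolding dref_iff[OF assms(2,1)] using assms(3) by blast
qed

lemma finite_NC: "finite (NC n)"
proof (rule finite_subset)
  show "NC n \<subseteq> Pow (Pow {1..n})"
  proof
    fix x assume "x \<in> NC n"
    then have "\<Union>x = {1..n}" using NC_partition_on by (simp add: partition_on_def)
    then show "x \<in> Pow (Pow {1..n})" by blast
  qed
qed simp

section \<open>Noncrossing partitions built from relations\<close>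

definition blocks_of :: "nat \<Rightarrow> (nat \<Rightarrow> nat \<Rightarrow> bool) \<Rightarrow> nat set set" where
  "blocks_of n R = (\<lambda>i. {j \<in> {1..n}. R i j}) ` {1..n}"

text \<open>Common source of the merges, single blocks and cuts used later. \<open>R\<close> may
  relate numbers outside \<open>{1..n}\<close>, which is why the second claim carries
  bounds.\<close>

lemma blocks_of_NC:
  assumes refl: "\<And>i. 1 \<le> i \<Longrightarrow> i \<le> n \<Longrightarrow> R i i"
    and sym: "\<And>i j. R i j \<Longrightarrow> R j i"
    and trans: "\<And>i j k. R i j \<Longrightarrow> R j k \<Longrightarrow> R i k"
    and nc: "\<And>i j k l. 1 \<le> i \<Longrightarrow> i < j \<Longrightarrow> j < k \<Longrightarrow> k < l \<Longrightarrow> l \<le> n \<Longrightarrow> R i k \<Longrightarrow> R j l \<Longrightarrow> R i j"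
  shows "blocks_of n R \<in> NC n"
    and "same_block (blocks_of n R) i j \<longleftrightarrow> 1 \<le> i \<and> i \<le> n \<and> 1 \<le> j \<and> j \<le> n \<and> R i j"
proof -
  have sb: "same_block (blocks_of n R) i j \<longleftrightarrow> 1 \<le> i \<and> i \<le> n \<and> 1 \<le> j \<and> j \<le> n \<and> R i j" for i j
  proof
    assume "same_block (blocks_of n R) i j"
    then obtain a where "a \<in> {1..n}" "R a i" "R a j" "i \<in> {1..n}" "j \<in> {1..n}"
      by (auto simp: same_block_def blocks_of_def)
    moreover have "R i j" using trans[OF sym] calculation(2,3) .
    ultimately show "1 \<le> i \<and> i \<le> n \<and> 1 \<le> j \<and> j \<le> n \<and> R i j" by simp
  next
    assume "1 \<le> i \<and> i \<le> n \<and> 1 \<le> j \<and> j \<le> n \<and> R i j"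
    then show "same_block (blocks_of n R) i j"
      using refl[of i] by (auto simp: same_block_def blocks_of_def)
  qed
  have "partition_on {1..n} (blocks_of n R)"
  proof (rule partition_onI)
    show "\<Union>(blocks_of n R) = {1..n}" using refl by (auto simp: blocks_of_def)
    show "{} \<notin> blocks_of n R" using refl by (force simp: blocks_of_def)
    show "disjnt p p'" if p: "p \<in> blocks_of n R" "p' \<in> blocks_of n R" "p \<noteq> p'" for p p'
    proof -
      obtain a b where ab: "p = {j \<in> {1..n}. R a j}" "p' = {j \<in> {1..n}. R b j}"
        using p by (auto simp: blocks_of_def)
      have False if "R a i" "R b i" for i
      proof -
        have "R a b" "R b a" using that trans sym by blast+
        then have "R a j \<longleftrightarrow> R b j" for j using trans by blast
        then show False using p(3) ab by simp
      qed
      then show ?thesis unfolding ab disjnt_def by blast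
    qed
  qed
  then show "blocks_of n R \<in> NC n" unfolding NC_def mem_Collect_eq sb using nc by blast
  show "same_block (blocks_of n R) i j \<longleftrightarrow> 1 \<le> i \<and> i \<le> n \<and> 1 \<le> j \<and> j \<le> n \<and> R i j" by (rule sb)
qed

section \<open>Membership in \<open>PE n\<close> and the two extreme partitions\<close>

text \<open>Relational form of \<open>{n}\<close> being a block, convenient because it passes to
  every refinement.\<close>

definition alone :: "nat \<Rightarrow> nat set set \<Rightarrow> bool" where
  "alone n x \<longleftrightarrow> (\<forall>j. same_block x j n \<longrightarrow> j = n)"

lemma singleton_mem_NC:
  assumes "x \<in> NC n" "1 \<le> n"
  shows "{n} \<in> x \<longleftrightarrow> alone n x"
proof -
  have "{n} \<in> x \<longleftrightarrow> {n} = {j. same_block x n j}"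
    using mem_NC_iff[OF assms(1), of n "{n}"] assms(2) by simp
  also have "\<dots> \<longleftrightarrow> alone n x"
    unfolding alone_def using same_block_sym[of x] same_block_refl[OF assms(1), of n] assms(2) by blast
  finally show ?thesis .
qed

lemma alone_mono: "dref n x y \<Longrightarrow> alone n y \<Longrightarrow> alone n x"
  unfolding alone_def using same_block_mono by blast

lemma mem_PE_iff:
  assumes n: "n \<ge> 3"
  shows "x \<in> PE n \<longleftrightarrow> x \<in> NC n \<and>
    \<not> (same_block x (n - 1) n \<and> (\<forall>j. same_block x j n \<longrightarrow> j = n - 1 \<or> j = n)) \<and>
    \<not> (same_block x 1 (n - 1) \<and> alone n x)"
proof -
  have "{n - 1, n} \<in> x \<longleftrightarrow> same_block x (n - 1) n \<and> (\<forall>j. same_block x j n \<longrightarrow> j = n - 1 \<or> j = n)"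
    if x: "x \<in> NC n"
  proof -
    have "{n - 1, n} \<in> x \<longleftrightarrow> {n - 1, n} = {j. same_block x n j}"
      using mem_NC_iff[OF x, of n "{n - 1, n}"] n by simp
    also have "{j. same_block x n j} = {j. same_block x j n}"
      using same_block_sym[of x] by blast
    also have "{n - 1, n} = \<dots> \<longleftrightarrow> same_block x (n - 1) n \<and> (\<forall>j. same_block x j n \<longrightarrow> j = n - 1 \<or> j = n)"
      using same_block_refl[OF x, of n] n by auto
    finally show ?thesis .
  qed
  then show ?thesis using singleton_mem_NC[of x n] n unfolding PE_def by auto
qed

lemma PE_NC: "x \<in> PE n \<Longrightarrow> x \<in> NC n"
  by (simp add: PE_def)

lemma same_block_singletons:
  "same_block (singletons_partition n) i j \<longleftrightarrow> 1 \<le> i \<and> i \<le> n \<and> i = j"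
  by (auto simp: same_block_def singletons_partition_def)

lemma same_block_one_block:
  "same_block (one_block_partition n) i j \<longleftrightarrow> 1 \<le> i \<and> i \<le> n \<and> 1 \<le> j \<and> j \<le> n"
  by (auto simp: same_block_def one_block_partition_def)

lemma singletons_NC: "singletons_partition n \<in> NC n"
proof -
  have "partition_on {1..n} (singletons_partition n)"
    by (rule partition_onI) (auto simp: singletons_partition_def)
  then show ?thesis unfolding NC_def mem_Collect_eq same_block_singletons by simp
qed

lemma one_block_NC: "1 \<le> n \<Longrightarrow> one_block_partition n \<in> NC n"
proof -
  assume "1 \<le> n"
  then have "partition_on {1..n} (one_block_partition n)"
    by (intro partition_onI) (auto simp: one_block_partition_def)
  then show ?thesis unfolding NC_def mem_Collect_eq same_block_one_block by simp
qed

section \<open>Covers and their labels\<close>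

definition merge_blocks :: "nat \<Rightarrow> nat set set \<Rightarrow> nat \<Rightarrow> nat \<Rightarrow> nat set set" where
  "merge_blocks n x a b = blocks_of n (\<lambda>i j. same_block x i j \<or>
     (same_block x a i \<or> same_block x b i) \<and> (same_block x a j \<or> same_block x b j))"


text \<open>The union of two blocks may cross a third one, so noncrossing is left as the premise
  \<open>nc\<close>, to be checked for each choice of \<open>a\<close> and \<open>b\<close>.\<close>

lemma merge_blocks_NC:
  assumes x: "x \<in> NC n"
    and nc: "\<And>i j k l. i < j \<Longrightarrow> j < k \<Longrightarrow> k < l \<Longrightarrow>
      same_block x i k \<or> (same_block x a i \<or> same_block x b i) \<and> (same_block x a k \<or> same_block x b k) \<Longrightarrow>
      same_block x j l \<or> (same_block x a j \<or> same_block x b j) \<and> (same_block x a l \<or> same_block x b l) \<Longrightarrow>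
      same_block x i j \<or> (same_block x a i \<or> same_block x b i) \<and> (same_block x a j \<or> same_block x b j)"
  shows "merge_blocks n x a b \<in> NC n"
    and "same_block (merge_blocks n x a b) i j \<longleftrightarrow> same_block x i j \<or>
      (same_block x a i \<or> same_block x b i) \<and> (same_block x a j \<or> same_block x b j)"
proof -
  let ?R = "\<lambda>i j. same_block x i j \<or>
     (same_block x a i \<or> same_block x b i) \<and> (same_block x a j \<or> same_block x b j)"
  note tr = same_block_trans[OF x]
  have 1: "?R i i" if "1 \<le> i" "i \<le> n" for i using same_block_refl[OF x that] by blast
  have 2: "?R j i" if "?R i j" for i j using that same_block_sym by blast
  have 3: "?R i k" if "?R i j" "?R j k" for i j k
  proof -
    have mm: "same_block x c q" if "same_block x c p" "same_block x p q" for c p q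
      using tr that by blast
    show ?thesis using that(1)
    proof (elim disjE[of "same_block x i j"])
      assume ij: "same_block x i j"
      then show ?thesis using that(2) mm[of _ j i] mm[of i j k] same_block_sym[OF ij] by blast
    next
      assume m: "(same_block x a i \<or> same_block x b i) \<and> (same_block x a j \<or> same_block x b j)"
      then show ?thesis using that(2) mm[of _ j k] by blast
    qed
  qed
  show "merge_blocks n x a b \<in> NC n"
    unfolding merge_blocks_def by (rule blocks_of_NC(1)[of n ?R, OF 1 2 3]) (use nc in auto)
  have "same_block (merge_blocks n x a b) i j \<longleftrightarrow> 1 \<le> i \<and> i \<le> n \<and> 1 \<le> j \<and> j \<le> n \<and> ?R i j"
    unfolding merge_blocks_def by (rule blocks_of_NC(2)[of n ?R, OF 1 2 3]) (use nc in auto)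
  then show "same_block (merge_blocks n x a b) i j \<longleftrightarrow> ?R i j"
    using same_block_range[OF x] by blast
qed

text \<open>Some block of \<open>y\<close> splits in \<open>x\<close>. Let \<open>a\<close> be its
  minimum and \<open>d\<close> its least element outside the \<open>x\<close>-block of
  \<open>a\<close>. Merging the \<open>x\<close>-blocks of \<open>a\<close> and \<open>d\<close>
  gives a noncrossing partition properly above \<open>x\<close> and below \<open>y\<close>, hence
  \<open>y\<close> itself.\<close>

lemma cover_is_merge:
  assumes cov: "covers_on (NC n) (dref n) x y"
  obtains a d where "a < d" "\<not> same_block x a d" "same_block x a a" "same_block x d d"
    "\<And>i. same_block x a i \<Longrightarrow> a \<le> i" "\<And>i. same_block x d i \<Longrightarrow> d \<le> i"
    "\<And>i j. same_block y i j \<longleftrightarrow> same_block x i j \<or>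
      (same_block x a i \<or> same_block x d i) \<and> (same_block x a j \<or> same_block x d j)"
proof -
  have x: "x \<in> NC n" and y: "y \<in> NC n" and neq: "x \<noteq> y" and le: "dref n x y"
    and mid: "\<And>z. z \<in> NC n \<Longrightarrow> dref n x z \<Longrightarrow> dref n z y \<Longrightarrow> z = x \<or> z = y"
    using cov unfolding covers_on_def by auto
  note xtr = same_block_trans[OF x] and ytr = same_block_trans[OF y] and up = same_block_mono[OF le]
  obtain p q where pq: "same_block y p q" "\<not> same_block x p q"
    using NC_eqI[OF x y] up neq by blast
  have pp: "same_block y p p" using same_block_range[OF y pq(1)] same_block_refl[OF y] by blast
  define a where "a = (LEAST k. same_block y p k)"
  have pa: "same_block y p a" unfolding a_def using pp by (rule LeastI)
  have a_le: "a \<le> k" if "same_block y p k" for k unfolding a_def using that by (rule Least_le)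
  have ex: "\<exists>k. same_block y p k \<and> \<not> same_block x a k"
    using pq pp xtr same_block_sym by blast
  define d where "d = (LEAST k. same_block y p k \<and> \<not> same_block x a k)"
  have pd: "same_block y p d" and nad: "\<not> same_block x a d"
    using LeastI_ex[OF ex] unfolding d_def by blast+
  have d_le: "d \<le> k" if "same_block y p k" "\<not> same_block x a k" for k
    unfolding d_def using that by (intro Least_le) blast
  have aa: "same_block x a a" using same_block_range[OF y pa] same_block_refl[OF x] by blast
  have dd: "same_block x d d" using same_block_range[OF y pd] same_block_refl[OF x] by blast
  have ad: "a < d" using a_le[OF pd] aa nad by (metis le_neq_implies_less)
  have pm: "same_block y p i" if "same_block x a i \<or> same_block x d i" for i
    using that up ytr pa pd by blast
  have cross: "same_block x i j \<or> (same_block x a i \<or> same_block x d i) \<and> (same_block x a j \<or> same_block x d j)"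
    if o: "i < j" "j < k" "k < l"
      and ik: "same_block x i k \<or> (same_block x a i \<or> same_block x d i) \<and> (same_block x a k \<or> same_block x d k)"
      and jl: "same_block x j l \<or> (same_block x a j \<or> same_block x d j) \<and> (same_block x a l \<or> same_block x d l)"
    for i j k l
  proof -
    \<comment> \<open>Members of the \<open>y\<close>-block outside both parts exceed both minima. A
      block of \<open>x\<close> crossing the union lies in the \<open>y\<close>-block, so it would
      already cross one of the two parts.\<close>
    have later: "a < k \<and> d < k" if "same_block y p k" "\<not> same_block x a k" "\<not> same_block x d k" for k
    proof -
      have "d \<le> k" "k \<noteq> d" using d_le that dd by blast+
      then show ?thesis using ad by simp
    qed
    consider "same_block x i k" "same_block x j l"
      | "same_block x i k" "\<not> same_block x j l" "same_block x a j \<or> same_block x d j" "same_block x a l \<or> same_block x d l"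
      | "\<not> same_block x i k" "same_block x a i \<or> same_block x d i" "same_block x a k \<or> same_block x d k" "same_block x j l"
      | "same_block x a i \<or> same_block x d i" "same_block x a j \<or> same_block x d j"
      using ik jl by blast
    then show ?thesis
    proof cases
      case 1
      then show ?thesis using noncrossing[OF x o] by blast
    next
      case 2
      have "same_block y j l" using pm[OF 2(3)] pm[OF 2(4)] ytr same_block_sym by blast
      then have "same_block y i j" using noncrossing[OF y o] up 2(1) by blast
      then have pi: "same_block y p i" using pm[OF 2(3)] ytr same_block_sym by blast
      show ?thesis
      proof (cases "same_block x a i \<or> same_block x d i")
        case False
        then have *: "a < i" "d < i" using later pi by blast+
        have "same_block x a j \<Longrightarrow> same_block x a i" "same_block x d j \<Longrightarrow> same_block x d i"
          using noncrossing[OF x _ o(1,2) _ 2(1)] * by blast+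
        then show ?thesis using 2 False by blast
      qed (use 2 in blast)
    next
      case 3
      have "same_block y i k" using pm[OF 3(2)] pm[OF 3(3)] ytr same_block_sym by blast
      then have "same_block y i j" using noncrossing[OF y o] up 3(4) by blast
      then have pj: "same_block y p j" using pm[OF 3(2)] ytr by blast
      show ?thesis
      proof (cases "same_block x a j \<or> same_block x d j")
        case False
        then have "a < j" "d < j" using later pj by blast+
        then have "same_block x a k \<Longrightarrow> same_block x a j" "same_block x d k \<Longrightarrow> same_block x d j"
          using noncrossing[OF x _ o(2,3) _ 3(4)] by blast+
        then show ?thesis using 3(3) False by blast
      qed (use 3 in blast)
    qed blast
  qed
  have z: "merge_blocks n x a d \<in> NC n"
    by (rule merge_blocks_NC(1)[OF x]) (rule cross, assumption+)
  have zi: "same_block (merge_blocks n x a d) i j \<longleftrightarrow> same_block x i j \<or>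
      (same_block x a i \<or> same_block x d i) \<and> (same_block x a j \<or> same_block x d j)" for i j
    by (rule merge_blocks_NC(2)[OF x]) (rule cross, assumption+)
  have "dref n x (merge_blocks n x a d)" using dref_iff[OF x z] zi by blast
  moreover have "dref n (merge_blocks n x a d) y"
    unfolding dref_iff[OF z y] zi
  proof (intro allI impI, elim disjE[of "same_block x _ _"])
    fix i j assume "(same_block x a i \<or> same_block x d i) \<and> (same_block x a j \<or> same_block x d j)"
    then have "same_block y p i" "same_block y p j" using pm by simp_all
    then show "same_block y i j" by (rule ytr[OF same_block_sym])
  qed (rule up)
  moreover have "merge_blocks n x a d \<noteq> x" using zi[of a d] nad aa dd by metis
  ultimately have "merge_blocks n x a d = y" using mid z by blast
  moreover have "a \<le> i" if "same_block x a i" for i using that a_le pm by blast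
  moreover have "d \<le> i" if "same_block x d i" for i
  proof -
    have "\<not> same_block x a i" using that nad xtr same_block_sym by blast
    then show ?thesis using that d_le pm by blast
  qed
  ultimately show thesis using that[OF ad nad aa dd] zi by blast
qed

text \<open>Let \<open>A\<close> and \<open>D\<close> be the merged blocks, with
  \<open>Min A < Min D\<close>. The label is the largest element of \<open>A\<close> below all of
  \<open>D\<close>. If it is \<open>n - 1\<close>, then \<open>D\<close> has no element below
  \<open>n - 1\<close>, and disjointness from \<open>A\<close> forces
  \<open>D = {n}\<close>.\<close>

lemma parking_label_cover:
  assumes cov: "covers_on (NC n) (dref n) x y" and n: "n \<ge> 1"
  shows "parking_label x y = n - 1 \<longleftrightarrow> alone n x \<and> same_block y (n - 1) n"
proof -
  have x: "x \<in> NC n" and y: "y \<in> NC n" using cov unfolding covers_on_def by auto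
  obtain a d where ad: "a < d" "\<not> same_block x a d" and aa: "same_block x a a" and dd: "same_block x d d"
    and a_le: "\<And>i. same_block x a i \<Longrightarrow> a \<le> i" and d_le: "\<And>i. same_block x d i \<Longrightarrow> d \<le> i"
    and yi: "\<And>i j. same_block y i j \<longleftrightarrow> same_block x i j \<or>
      (same_block x a i \<or> same_block x d i) \<and> (same_block x a j \<or> same_block x d j)"
    by (rule cover_is_merge[OF cov]) (rule that)
  note tr = same_block_trans[OF x] and rng = same_block_range[OF x]
  define A where "A = {j. same_block x a j}"
  define D where "D = {j. same_block x d j}"
  have Ax: "A \<in> x" using mem_NC_iff[OF x, of a A] aa rng[OF aa] by (simp add: A_def)
  have Dx: "D \<in> x" using mem_NC_iff[OF x, of d D] dd rng[OF dd] by (simp add: D_def)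
  have sub: "A \<subseteq> {..n}" "D \<subseteq> {..n}" using rng by (auto simp: A_def D_def)
  have fin: "finite A" "finite D" using sub finite_subset by blast+
  have minA: "Min A = a" by (rule Min_eqI) (use fin aa a_le in \<open>auto simp: A_def\<close>)
  have minD: "Min D = d" by (rule Min_eqI) (use fin dd d_le in \<open>auto simp: D_def\<close>)
  have "{j. same_block y a j} = A \<union> D"
  proof (rule set_eqI)
    fix j
    show "j \<in> {j. same_block y a j} \<longleftrightarrow> j \<in> A \<union> D" using yi[of a j] aa by (auto simp: A_def D_def)
  qed
  then have ADy: "A \<union> D \<in> y"
    using mem_NC_iff[OF y, of a "A \<union> D"] aa rng[OF aa] by (simp add: A_def)
  define L where "L = {j \<in> A. \<forall>i\<in>D. j \<le> i}"
  have block: "B = A \<or> B = D" if "B \<in> x" "b \<in> B" "same_block x a b \<or> same_block x d b" for B b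
  proof -
    have "b \<in> A \<or> b \<in> D" using that(3) by (simp add: A_def D_def)
    then show ?thesis using block_eq[OF x that(1,2)] block_eq[OF x Ax, of b] block_eq[OF x Dx, of b] by metis
  qed
  \<comment> \<open>Two elements joined in \<open>y\<close> but not in \<open>x\<close> come from
    \<open>A\<close> and \<open>D\<close>, one from each; so the pair of blocks is unique up to
    order, and the minima fix the order.\<close>
  have label: "parking_label x y = Max L"
    unfolding parking_label_def
  proof (rule the_equality)
    show "\<exists>B1\<in>x. \<exists>B2\<in>x. B1 \<union> B2 \<in> y \<and> Min B1 < Min B2 \<and> Max L = Max {j \<in> B1. \<forall>i\<in>B2. j \<le> i}"
      unfolding L_def using Ax Dx ADy minA minD ad(1) by (intro bexI[of _ A] bexI[of _ D]) auto
    fix m assume "\<exists>B1\<in>x. \<exists>B2\<in>x. B1 \<union> B2 \<in> y \<and> Min B1 < Min B2 \<and> m = Max {j \<in> B1. \<forall>i\<in>B2. j \<le> i}"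
    then obtain B1 B2 where B: "B1 \<in> x" "B2 \<in> x" "B1 \<union> B2 \<in> y" "Min B1 < Min B2"
      and m: "m = Max {j \<in> B1. \<forall>i\<in>B2. j \<le> i}" by blast
    have "{} \<notin> x" using NC_partition_on[OF x] by (simp add: partition_on_def)
    then have "B1 \<noteq> {}" "B2 \<noteq> {}" using B(1,2) by blast+
    then obtain b1 b2 where b: "b1 \<in> B1" "b2 \<in> B2" by blast
    have "same_block y b1 b2" unfolding same_block_def using b by (intro bexI[OF _ B(3)]) simp
    moreover have "\<not> same_block x b1 b2"
    proof
      assume "same_block x b1 b2"
      then have "b2 \<in> B1" using block_eq[OF x B(1) b(1)] by blast
      then have "B1 = B2" using block_eq[OF x B(1)] block_eq[OF x B(2) b(2)] by metis
      then show False using B(4) by simp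
    qed
    ultimately have "same_block x a b1 \<or> same_block x d b1" "same_block x a b2 \<or> same_block x d b2"
      using yi[of b1 b2] by simp_all
    then have "B1 = A \<or> B1 = D" "B2 = A \<or> B2 = D" using block B(1,2) b by simp_all
    then have "B1 = A" "B2 = D" using B(4) minA minD ad(1) by auto
    then show "m = Max L" using m by (simp add: L_def)
  qed
  have finL: "finite L" using fin by (simp add: L_def)
  have "a \<in> L" using aa d_le ad(1) by (fastforce simp: L_def A_def D_def)
  then have maxL: "Max L \<in> L" using finL Max_in by blast
  show ?thesis
  proof
    assume "parking_label x y = n - 1"
    then have "n - 1 \<in> L" using label maxL by simp
    then have an: "same_block x a (n - 1)" and D: "\<And>i. same_block x d i \<Longrightarrow> n - 1 \<le> i"
      by (auto simp: L_def A_def D_def)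
    have Dn: "i = n" if "same_block x d i" for i
    proof -
      have "i \<noteq> n - 1"
      proof
        assume "i = n - 1"
        then have "same_block x a d" using an that tr same_block_sym by blast
        then show False using ad(2) by blast
      qed
      then show ?thesis using D[OF that] rng(4)[OF that] by simp
    qed
    have d: "d = n" using Dn[OF dd] .
    have "alone n x" unfolding alone_def using Dn same_block_sym unfolding d by blast
    moreover have "same_block y (n - 1) n" using yi an dd d by blast
    ultimately show "alone n x \<and> same_block y (n - 1) n" by blast
  next
    assume al: "alone n x \<and> same_block y (n - 1) n"
    have alj: "j = n" if "same_block x n j \<or> same_block x j n" for j
      using al that same_block_sym unfolding alone_def by blast
    have "\<not> same_block x (n - 1) n" using alj[of "n - 1"] n by auto
    then have m: "same_block x a (n - 1) \<or> same_block x d (n - 1)" "same_block x a n \<or> same_block x d n"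
      using al yi[of "n - 1" n] by simp_all
    have "\<not> same_block x a n"
    proof
      assume "same_block x a n"
      then have "a = n" using alj by blast
      then show False using ad(1) rng(2)[OF dd] by simp
    qed
    then have d: "d = n" using m(2) alj by blast
    then have Dn: "D = {n}" using alj dd by (auto simp: D_def)
    have "\<not> same_block x d (n - 1)" using alj[of "n - 1"] d n by auto
    then have "n - 1 \<in> A" using m(1) by (simp add: A_def)
    moreover have "n \<notin> A" using \<open>\<not> same_block x a n\<close> by (simp add: A_def)
    ultimately have "n - 1 \<in> L" "\<And>j. j \<in> L \<Longrightarrow> j \<le> n - 1"
      using Dn sub(1) by (auto simp: L_def le_less)
    then have "Max L = n - 1" using finL by (intro Max_eqI) auto
    then show "parking_label x y = n - 1" using label by simp
  qed
qed

section \<open>The induced order\<close>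

text \<open>For positive \<open>n\<close> these are the covers with label other than
  \<open>n - 1\<close>, by \<open>parking_label_cover\<close>.\<close>

definition good_cover :: "nat \<Rightarrow> nat set set \<Rightarrow> nat set set \<Rightarrow> bool" where
  "good_cover n x y \<longleftrightarrow> covers_on (NC n) (dref n) x y \<and> \<not> (alone n x \<and> same_block y (n - 1) n)"

section \<open>Paths of good covers\<close>

lemma good_path_dref:
  assumes "(good_cover n)\<^sup>*\<^sup>* x y" "x \<in> NC n"
  shows "y \<in> NC n \<and> dref n x y"
  using assms
proof (induction rule: rtranclp_induct)
  case base
  then show ?case by (simp add: dref_refl)
next
  case (step y z)
  then have "dref n y z" "z \<in> NC n" by (simp_all add: good_cover_def covers_on_def)
  then show ?case using step dref_trans by blast
qed

lemma cover_exists: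
  assumes "x \<in> NC n" "y \<in> NC n" "dref n x y" "x \<noteq> y"
  shows "\<exists>v. covers_on (NC n) (dref n) x v \<and> dref n v y"
proof -
  define W where "W = {v \<in> NC n. dref n x v \<and> dref n v y \<and> v \<noteq> x}"
  define lt where "lt u v \<longleftrightarrow> dref n u v \<and> u \<noteq> v" for u v
  have "finite W" using finite_NC by (simp add: W_def)
  moreover have "y \<in> W" using assms dref_refl by (simp add: W_def)
  moreover have "transp_on W lt" 
    unfolding lt_def by (intro transp_onI) (metis dref_trans dref_antisym)
  moreover have "asymp_on W lt"
    unfolding lt_def by (intro asymp_onI) (metis dref_antisym)
  ultimately obtain v where v: "v \<in> W" "\<And>u. u \<in> W \<Longrightarrow> u \<noteq> v \<Longrightarrow> \<not> lt u v"
    using Finite_Set.bex_min_element[of W lt] by (metis empty_iff)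
  have "u = x \<or> u = v" if "u \<in> NC n" "dref n x u" "dref n u v" for u
  proof (rule ccontr)
    assume ne: "\<not> (u = x \<or> u = v)"
    have "dref n u y" using that(3) v(1) dref_trans[of n u v y] by (simp add: W_def)
    then have "u \<in> W" using that ne by (simp add: W_def)
    then show False using v(2) ne that(3) by (simp add: lt_def)
  qed
  then show ?thesis using v(1) assms(1) unfolding covers_on_def W_def by auto
qed

text \<open>Any cover below \<open>y\<close> will do as a first step: if \<open>n\<close> is not
  alone in \<open>x\<close>, or \<open>n - 1\<close> and \<open>n\<close> are separated in
  \<open>y\<close>, the same holds for all pairs in between, so no forbidden step can occur.\<close>

lemma good_path:
  assumes "x \<in> NC n" "y \<in> NC n" "dref n x y" "\<not> (alone n x \<and> same_block y (n - 1) n)"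
  shows "(good_cover n)\<^sup>*\<^sup>* x y"
  using assms
proof (induction "card {v \<in> NC n. dref n x v \<and> dref n v y}" arbitrary: x rule: less_induct)
  case less
  show ?case
  proof (cases "x = y")
    case False
    then obtain v where v: "covers_on (NC n) (dref n) x v" "dref n v y"
      using cover_exists less.prems by blast
    have xv: "v \<in> NC n" "dref n x v" "x \<noteq> v" using v(1) by (auto simp: covers_on_def)
    have nb: "\<not> (alone n v \<and> same_block y (n - 1) n)" using less.prems(4) alone_mono[OF xv(2)] by blast
    have "\<not> (alone n x \<and> same_block v (n - 1) n)" using less.prems(4) same_block_mono[OF v(2)] by blast
    then have g: "good_cover n x v" using v(1) by (simp add: good_cover_def)
    have "card {u \<in> NC n. dref n v u \<and> dref n u y} < card {u \<in> NC n. dref n x u \<and> dref n u y}"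
    proof (rule psubset_card_mono)
      show "finite {u \<in> NC n. dref n x u \<and> dref n u y}" using finite_NC by simp
      have "x \<notin> {u \<in> NC n. dref n v u \<and> dref n u y}" using xv dref_antisym by blast
      moreover have "x \<in> {u \<in> NC n. dref n x u \<and> dref n u y}" using less.prems dref_refl by blast
      moreover have "{u \<in> NC n. dref n v u \<and> dref n u y} \<subseteq> {u \<in> NC n. dref n x u \<and> dref n u y}"
        using dref_trans[OF xv(2)] by blast
      ultimately show "{u \<in> NC n. dref n v u \<and> dref n u y} \<subset> {u \<in> NC n. dref n x u \<and> dref n u y}" by blast
    qed
    then have "(good_cover n)\<^sup>*\<^sup>* v y" using less.hyps xv(1) less.prems(2) v(2) nb by blast
    then show ?thesis by (rule converse_rtranclp_into_rtranclp[of "good_cover n", OF g])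
  qed simp
qed

text \<open>
  A path of good covers from \<open>x\<close> to \<open>y\<close> must merge \<open>{n}\<close> with a block that avoids \<open>n - 1\<close>.  If the
  minimum \<open>m\<close> of the \<open>y\<close>-block of \<open>n\<close> shares an \<open>x\<close>-block with \<open>n - 1\<close>, the merged block crosses that one;
  otherwise \<open>{n}\<close> can be merged with the block of \<open>m\<close> first.
\<close>
definition root_free :: "nat \<Rightarrow> nat set set \<Rightarrow> nat set set \<Rightarrow> bool" where
  "root_free n x y \<longleftrightarrow> (alone n x \<and> same_block y (n - 1) n \<longrightarrow>
     (\<exists>m. same_block y m n \<and> (\<forall>j. same_block y j n \<longrightarrow> m \<le> j) \<and> \<not> same_block x m (n - 1)))"

text \<open>In the critical case the path passes through the merge of \<open>{n}\<close> with the
  \<open>x\<close>-block of \<open>m\<close>. The merge separates \<open>n - 1\<close> from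
  \<open>n\<close>, and \<open>n\<close> is not alone in it, so \<open>good_path\<close> handles
  both halves. A block crossing the union would lie in the \<open>y\<close>-block of
  \<open>n\<close>, hence to the right of its minimum \<open>m\<close>, and would cross the block of
  \<open>m\<close> already in \<open>x\<close>.\<close>

lemma good_path_of_root_free:
  assumes n: "n \<ge> 2" and x: "x \<in> NC n" and y: "y \<in> NC n" and le: "dref n x y" and rf: "root_free n x y"
  shows "(good_cover n)\<^sup>*\<^sup>* x y"
proof (cases "alone n x \<and> same_block y (n - 1) n")
  case False
  then show ?thesis using good_path[OF x y le] by blast
next
  case True
  then obtain m where mn: "same_block y m n" and m_le: "\<And>j. same_block y j n \<Longrightarrow> m \<le> j"
    and nm: "\<not> same_block x m (n - 1)" using rf unfolding root_free_def by blast
  note tr = same_block_trans[OF x] and ytr = same_block_trans[OF y] and up = same_block_mono[OF le]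
  have alj: "j = n" if "same_block x n j" for j
    using True same_block_sym[OF that] unfolding alone_def by blast
  have "m \<le> n - 1" using m_le True by blast
  then have m_ne: "m \<noteq> n" using n by simp
  have mm: "same_block x m m" using same_block_range[OF y mn] same_block_refl[OF x] by blast
  have nn: "same_block x n n" using same_block_refl[OF x, of n] n by simp
  have cross: "same_block x i j \<or> (same_block x m i \<or> same_block x n i) \<and> (same_block x m j \<or> same_block x n j)"
    if o: "i < j" "j < k" "k < l"
      and ik: "same_block x i k \<or> (same_block x m i \<or> same_block x n i) \<and> (same_block x m k \<or> same_block x n k)"
      and jl: "same_block x j l \<or> (same_block x m j \<or> same_block x n j) \<and> (same_block x m l \<or> same_block x n l)"
    for i j k l
  proof -
    have "l \<le> n" using jl same_block_range(4)[OF x] by blast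
    then have "i \<noteq> n" "j \<noteq> n" "k \<noteq> n" using o by simp_all
    then have ni: "\<not> same_block x n i" "\<not> same_block x n j" "\<not> same_block x n k" using alj by blast+
    have sik: "same_block x i k" using ik ni tr same_block_sym by blast
    show ?thesis
    proof (cases "same_block x j l")
      case True
      then show ?thesis using noncrossing[OF x o sik] by blast
    next
      case False
      then have mj: "same_block x m j" using jl ni by blast
      then have "\<not> same_block x m l" using False tr same_block_sym by blast
      then have l: "l = n" using False jl alj by blast
      have yjn: "same_block y j n" using up[OF mj] mn ytr same_block_sym by blast
      then have "same_block y i j" using noncrossing[OF y o up[OF sik]] l by simp
      then have "m \<le> i" using m_le ytr yjn by blast
      then have "same_block x m i"
        using mm noncrossing[OF x _ o(1,2) mj sik] by (cases "m = i") simp_all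
      then show ?thesis using mj by blast
    qed
  qed
  have z: "merge_blocks n x m n \<in> NC n"
    by (rule merge_blocks_NC(1)[OF x]) (rule cross, assumption+)
  have zi: "same_block (merge_blocks n x m n) i j \<longleftrightarrow> same_block x i j \<or>
      (same_block x m i \<or> same_block x n i) \<and> (same_block x m j \<or> same_block x n j)" for i j
    by (rule merge_blocks_NC(2)[OF x]) (rule cross, assumption+)
  have xz: "dref n x (merge_blocks n x m n)" unfolding dref_iff[OF x z] zi by blast
  have zy: "dref n (merge_blocks n x m n) y"
    unfolding dref_iff[OF z y] zi
  proof (intro allI impI, elim disjE[of "same_block x _ _"])
    fix i j assume m: "(same_block x m i \<or> same_block x n i) \<and> (same_block x m j \<or> same_block x n j)"
    have "same_block y n k" if "same_block x m k \<or> same_block x n k" for k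
      using that up[of m k] up[of n k] ytr[OF same_block_sym[OF mn]] by blast
    then have "same_block y n i" "same_block y n j" using m by simp_all
    then show "same_block y i j" by (rule ytr[OF same_block_sym])
  qed (rule up)
  have "n - 1 \<noteq> n" using n by simp
  then have "\<not> same_block x n (n - 1)" using alj[of "n - 1"] by blast
  then have "\<not> same_block (merge_blocks n x m n) (n - 1) n"
    unfolding zi using nm same_block_sym by blast
  then have 1: "(good_cover n)\<^sup>*\<^sup>* x (merge_blocks n x m n)" using good_path[OF x z xz] by blast
  have "same_block (merge_blocks n x m n) m n" unfolding zi using mm nn by blast
  then have "\<not> alone n (merge_blocks n x m n)" using m_ne unfolding alone_def by blast
  then have "(good_cover n)\<^sup>*\<^sup>* (merge_blocks n x m n) y" using good_path[OF z y zy] by blast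
  with 1 show ?thesis by (rule rtranclp_trans)
qed

text \<open>For a first step from \<open>x\<close> to \<open>x'\<close>: if \<open>n\<close> is
  alone in \<open>x'\<close>, the witness for \<open>x'\<close> serves for \<open>x\<close>.
  Otherwise \<open>x'\<close> joins \<open>n\<close> to some \<open>a\<close> but not to
  \<open>n - 1\<close>; a minimum \<open>m\<close> in the \<open>x\<close>-block of
  \<open>n - 1\<close> would give crossing blocks of \<open>x'\<close> at
  \<open>m < a < n - 1 < n\<close>.\<close>

lemma root_free_of_good_path:
  assumes "n \<ge> 1" "(good_cover n)\<^sup>*\<^sup>* x y" "x \<in> NC n"
  shows "root_free n x y"
  using assms(2,3)
proof (induction rule: converse_rtranclp_induct)
  case base
  \<comment> \<open>Here \<open>alone\<close> would force \<open>n - 1 = n\<close>, which fails for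
    positive \<open>n\<close>.\<close>
  show ?case using assms(1) unfolding root_free_def alone_def by fastforce
next
  case (step x x')
  have x': "x' \<in> NC n" and le: "dref n x x'" and ng: "\<not> (alone n x \<and> same_block x' (n - 1) n)"
    using step.hyps(1) by (auto simp: good_cover_def covers_on_def)
  have IH: "root_free n x' y" using step.IH x' by blast
  have y: "y \<in> NC n" and x'y: "dref n x' y" using good_path_dref[OF step.hyps(2) x'] by blast+
  show ?case
    unfolding root_free_def
  proof
    assume al: "alone n x \<and> same_block y (n - 1) n"
    show "\<exists>m. same_block y m n \<and> (\<forall>j. same_block y j n \<longrightarrow> m \<le> j) \<and> \<not> same_block x m (n - 1)"
    proof (cases "alone n x'")
      case True
      then show ?thesis using IH al same_block_mono[OF le] unfolding root_free_def by blast
    next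
      case False
      then obtain a where a: "same_block x' a n" "a \<noteq> n" unfolding alone_def by blast
      define m where "m = (LEAST j. same_block y j n)"
      have "same_block y (n - 1) n" using al by (rule conjunct2)
      then have m: "same_block y m n" unfolding m_def by (rule LeastI)
      have m_le: "m \<le> j" if "same_block y j n" for j unfolding m_def using that by (rule Least_le)
      have nn: "\<not> same_block x' (n - 1) n" using ng al by blast
      have "\<not> same_block x m (n - 1)"
      proof
        assume "same_block x m (n - 1)"
        then have mn: "same_block x' m (n - 1)" by (rule same_block_mono[OF le])
        have "a \<noteq> n - 1" using a nn by blast
        moreover have "a \<le> n" using same_block_range(2)[OF x' a(1)] .
        ultimately have an: "a < n - 1" "n - 1 < n" using a(2) by simp_all
        have "m \<noteq> a"
          using mn a(1) nn same_block_trans[OF x'] same_block_sym by blast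
        then have "m < a" using m_le[OF same_block_mono[OF x'y a(1)]] by simp
        then have "same_block x' m a" using noncrossing[OF x' _ an mn a(1)] by blast
        then have "same_block x' m n" using same_block_trans[OF x'] a(1) by blast
        then have "same_block x' (n - 1) n" using same_block_trans[OF x' same_block_sym[OF mn]] by blast
        then show False using nn by blast
      qed
      then show ?thesis using m m_le by blast
    qed
  qed
qed

section \<open>Saturated chains and parking chains\<close>

text \<open>A maximal chain of the interval from \<open>a\<close> to \<open>b\<close>, with good
  covers only. Keeping the interval explicit allows chains to be concatenated.\<close>

definition saturated :: "nat \<Rightarrow> nat set set \<Rightarrow> nat set set \<Rightarrow> nat set set set \<Rightarrow> bool" where
  "saturated n a b C \<longleftrightarrow> a \<in> C \<and> b \<in> C \<and>
     (\<forall>c\<in>C. c \<in> NC n \<and> dref n a c \<and> dref n c b) \<and>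
     (\<forall>c\<in>C. \<forall>c'\<in>C. dref n c c' \<or> dref n c' c) \<and>
     (\<forall>z\<in>NC n. dref n a z \<longrightarrow> dref n z b \<longrightarrow> (\<forall>c\<in>C. dref n z c \<or> dref n c z) \<longrightarrow> z \<in> C) \<and>
     (\<forall>u v. covers_on C (dref n) u v \<longrightarrow> good_cover n u v)"

lemma saturated_refl: "a \<in> NC n \<Longrightarrow> saturated n a a {a}"
  unfolding saturated_def covers_on_def using dref_refl dref_antisym by blast

lemma saturated_step:
  assumes "good_cover n x y"
  shows "saturated n x y {x, y}"
proof -
  have c: "x \<in> NC n" "y \<in> NC n" "x \<noteq> y" "dref n x y"
    "\<And>z. z \<in> NC n \<Longrightarrow> dref n x z \<Longrightarrow> dref n z y \<Longrightarrow> z = x \<or> z = y"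
    using assms unfolding good_cover_def covers_on_def by auto
  have "\<not> dref n y x" using c dref_antisym by blast
  then show ?thesis
    unfolding saturated_def using c assms dref_refl by (auto simp: covers_on_def)
qed

text \<open>An element comparable to the common end \<open>b\<close> falls into one of the two
  intervals, and no consecutive pair can skip over \<open>b\<close>; so maximality and good covers
  carry over from the parts.\<close>

lemma saturated_trans:
  assumes C: "saturated n a b C" and C': "saturated n b c C'"
  shows "saturated n a c (C \<union> C')"
proof -
  have aC: "a \<in> C" "b \<in> C" and C_le: "\<And>u. u \<in> C \<Longrightarrow> u \<in> NC n \<and> dref n a u \<and> dref n u b"
    and Cc: "\<And>u v. u \<in> C \<Longrightarrow> v \<in> C \<Longrightarrow> dref n u v \<or> dref n v u"
    and Cs: "\<And>z. z \<in> NC n \<Longrightarrow> dref n a z \<Longrightarrow> dref n z b \<Longrightarrow> (\<forall>u\<in>C. dref n z u \<or> dref n u z) \<Longrightarrow> z \<in> C"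
    and Cg: "\<And>u v. covers_on C (dref n) u v \<Longrightarrow> good_cover n u v"
    using C unfolding saturated_def by blast+
  have bC: "b \<in> C'" "c \<in> C'" and C'_le: "\<And>u. u \<in> C' \<Longrightarrow> u \<in> NC n \<and> dref n b u \<and> dref n u c"
    and C'c: "\<And>u v. u \<in> C' \<Longrightarrow> v \<in> C' \<Longrightarrow> dref n u v \<or> dref n v u"
    and C's: "\<And>z. z \<in> NC n \<Longrightarrow> dref n b z \<Longrightarrow> dref n z c \<Longrightarrow> (\<forall>u\<in>C'. dref n z u \<or> dref n u z) \<Longrightarrow> z \<in> C'"
    and C'g: "\<And>u v. covers_on C' (dref n) u v \<Longrightarrow> good_cover n u v"
    using C' unfolding saturated_def by blast+
  have ab: "dref n a b" "dref n b c" using C_le[OF aC(2)] C'_le[OF bC(2)] by blast+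
  have CC': "dref n u v" if "u \<in> C" "v \<in> C'" for u v
    using dref_trans[of n u b v] C_le[OF that(1)] C'_le[OF that(2)] by blast
  show ?thesis
    unfolding saturated_def
  proof (intro conjI ballI allI impI)
    show "a \<in> C \<union> C'" "c \<in> C \<union> C'" using aC bC by blast+
    fix u assume u: "u \<in> C \<union> C'"
    show "u \<in> NC n" "dref n a u" "dref n u c"
      using u C_le[of u] C'_le[of u] dref_trans[OF ab(1), of u] dref_trans[OF _ ab(2), of u] by blast+
    fix v assume "v \<in> C \<union> C'"
    then show "dref n u v \<or> dref n v u" using u Cc[of u v] C'c[of u v] CC'[of u v] CC'[of v u] by blast
  next
    fix z assume z: "z \<in> NC n" "dref n a z" "dref n z c" "\<forall>u\<in>C \<union> C'. dref n z u \<or> dref n u z"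
    have "dref n z b \<or> dref n b z" using z(4) aC(2) by blast
    then show "z \<in> C \<union> C'" using Cs[of z] C's[of z] z by blast
  next
    fix u v assume cov: "covers_on (C \<union> C') (dref n) u v"
    then have uv: "u \<in> C \<union> C'" "v \<in> C \<union> C'" "u \<noteq> v" "dref n u v"
      and mid: "\<And>z. z \<in> C \<union> C' \<Longrightarrow> dref n u z \<Longrightarrow> dref n z v \<Longrightarrow> z = u \<or> z = v"
      unfolding covers_on_def by blast+
    have 1: "good_cover n u v" if "u \<in> C" "v \<in> C"
      by (rule Cg) (use that uv mid in \<open>simp add: covers_on_def\<close>)
    have 2: "good_cover n u v" if "u \<in> C'" "v \<in> C'"
      by (rule C'g) (use that uv mid in \<open>simp add: covers_on_def\<close>)
    have "good_cover n u v" if "u \<in> C" "v \<in> C'"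
    proof -
      have "b = u \<or> b = v" using mid[of b] aC(2) C_le[OF that(1)] C'_le[OF that(2)] by blast
      then show ?thesis using that aC(2) bC(1) 1 2 by blast
    qed
    moreover have "\<not> (u \<in> C' \<and> v \<in> C)" using CC'[of v u] uv(3,4) dref_antisym by blast
    ultimately show "good_cover n u v" using uv(1,2) 1 2 by blast
  qed
qed

lemma saturated_exists:
  assumes "(good_cover n)\<^sup>*\<^sup>* a b" "a \<in> NC n"
  shows "\<exists>C. saturated n a b C"
  using assms
proof (induction rule: rtranclp_induct)
  case base
  then show ?case using saturated_refl by blast
next
  case (step y z)
  then show ?case using saturated_trans[OF _ saturated_step[OF step.hyps(2)]] by blast
qed

lemma singletons_dref: "x \<in> NC n \<Longrightarrow> dref n (singletons_partition n) x"
  by (simp add: dref_iff singletons_NC same_block_singletons same_block_refl)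

lemma dref_one_block: "1 \<le> n \<Longrightarrow> x \<in> NC n \<Longrightarrow> dref n x (one_block_partition n)"
  unfolding dref_iff[OF _ one_block_NC] same_block_one_block using same_block_range by blast

text \<open>All of \<open>NC n\<close> lies between bottom and top, so maximality within this
  interval is maximality among all chains.\<close>

lemma saturated_parking_chain:
  assumes n: "n \<ge> 1" and C: "saturated n (singletons_partition n) (one_block_partition n) C"
  shows "C \<in> parking_chains n"
proof -
  have "pred_on.maxchain (NC n) (dref n) C"
    unfolding pred_on.maxchain_def
  proof (intro conjI notI)
    show "pred_on.chain (NC n) (dref n) C"
      unfolding pred_on.chain_def using C unfolding saturated_def by blast
    assume "\<exists>S. pred_on.chain (NC n) (dref n) S \<and> C \<subset> S"
    then obtain S z where S: "pred_on.chain (NC n) (dref n) S" "C \<subset> S" "z \<in> S" "z \<notin> C" by blast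
    then have z: "z \<in> NC n" unfolding pred_on.chain_def by blast
    have "\<forall>u\<in>C. dref n z u \<or> dref n u z"
    proof
      fix u assume "u \<in> C"
      then have "z = u \<or> dref n z u \<or> dref n u z" using S unfolding pred_on.chain_def by blast
      then show "dref n z u \<or> dref n u z" using dref_refl[OF z] by blast
    qed
    then have "z \<in> C" using C z singletons_dref[OF z] dref_one_block[OF n z] unfolding saturated_def by blast
    then show False using S(4) by blast
  qed
  moreover have "parking_label x y \<noteq> n - 1" if "covers_on C (dref n) x y" for x y
    using C that parking_label_cover[OF _ n, of x y] unfolding saturated_def good_cover_def by blast
  ultimately show ?thesis by (simp add: parking_chains_def)
qed

text \<open>A partition strictly between consecutive members is comparable to the whole chain and
  could be inserted; so by maximality consecutive members form covers of
  \<open>NC n\<close>.\<close>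

lemma parking_step_good_cover:
  assumes n: "n \<ge> 1" and C: "C \<in> parking_chains n" and cov: "covers_on C (dref n) x y"
  shows "good_cover n x y"
proof -
  have Cm: "pred_on.maxchain (NC n) (dref n) C" and lab: "parking_label x y \<noteq> n - 1"
    using C cov unfolding parking_chains_def by blast+
  have Cn: "C \<subseteq> NC n" and Cc: "\<And>u v. u \<in> C \<Longrightarrow> v \<in> C \<Longrightarrow> u = v \<or> dref n u v \<or> dref n v u"
    and mx: "\<And>S. pred_on.chain (NC n) (dref n) S \<Longrightarrow> \<not> C \<subset> S"
  proof -
    have ch: "pred_on.chain (NC n) (dref n) C" using Cm by (simp add: pred_on.maxchain_def)
    show "C \<subseteq> NC n" using ch by (simp add: pred_on.chain_def)
    show "u = v \<or> dref n u v \<or> dref n v u" if "u \<in> C" "v \<in> C" for u v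
      using pred_on.chain_total[OF ch that] by auto
    show "\<not> C \<subset> S" if "pred_on.chain (NC n) (dref n) S" for S
      using Cm that by (auto simp: pred_on.maxchain_def)
  qed
  have xy: "x \<in> C" "y \<in> C" "x \<noteq> y" "dref n x y"
    and mid: "\<And>z. z \<in> C \<Longrightarrow> dref n x z \<Longrightarrow> dref n z y \<Longrightarrow> z = x \<or> z = y"
    using cov unfolding covers_on_def by blast+
  have "z = x \<or> z = y" if z: "z \<in> NC n" "dref n x z" "dref n z y" for z
  proof (cases "z \<in> C")
    case True
    then show ?thesis using mid z by blast
  next
    case False
    have "dref n u z \<or> dref n z u" if u: "u \<in> C" for u
      using Cc[OF u xy(1)] Cc[OF u xy(2)] mid[OF u] z(2,3)
        dref_trans[OF _ z(2), of u] dref_trans[OF z(3), of u] by blast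
    then have "pred_on.chain (NC n) (dref n) (insert z C)"
      unfolding pred_on.chain_def using Cn Cc z(1) by blast
    then show ?thesis using mx[of "insert z C"] False by blast
  qed
  then have "covers_on (NC n) (dref n) x y"
    unfolding covers_on_def using xy Cn by blast
  then show ?thesis using lab parking_label_cover[OF _ n] unfolding good_cover_def by blast
qed

section \<open>Explicit description of the induced order\<close>

lemma pchn_imp_good_path: "n \<ge> 1 \<Longrightarrow> pchn n x y \<Longrightarrow> (good_cover n)\<^sup>*\<^sup>* x y"
  unfolding pchn_def by (erule rtranclp_mono[THEN predicate2D, rotated]) (use parking_step_good_cover in blast)

text \<open>Each step of the path extends by good paths down to the bottom and up to the top.
  Saturated chains along these, joined with the step, form a parking chain in which the step is
  consecutive.\<close>

lemma good_path_imp_pchn: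
  assumes n: "n \<ge> 1" and "(good_cover n)\<^sup>*\<^sup>* x y"
    and "(good_cover n)\<^sup>*\<^sup>* (singletons_partition n) x" "(good_cover n)\<^sup>*\<^sup>* y (one_block_partition n)"
  shows "pchn n x y"
  using assms(2-)
proof (induction rule: rtranclp_induct)
  case base
  then show ?case by (simp add: pchn_def)
next
  case (step y z)
  have y1: "(good_cover n)\<^sup>*\<^sup>* y (one_block_partition n)"
    using step.hyps(2) step.prems(2) by (rule converse_rtranclp_into_rtranclp[of "good_cover n"])
  have 0: "(good_cover n)\<^sup>*\<^sup>* (singletons_partition n) y"
    using step.prems(1) step.hyps(1) by (rule rtranclp_trans)
  have zN: "y \<in> NC n" "z \<in> NC n" using step.hyps(2) by (simp_all add: good_cover_def covers_on_def)
  obtain C1 where C1: "saturated n (singletons_partition n) y C1"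
    using saturated_exists[OF 0 singletons_NC] by blast
  obtain C2 where C2: "saturated n z (one_block_partition n) C2"
    using saturated_exists[OF step.prems(2) zN(2)] by blast
  define C where "C = (C1 \<union> {y, z}) \<union> C2"
  have "saturated n (singletons_partition n) (one_block_partition n) C"
    unfolding C_def by (rule saturated_trans[OF saturated_trans[OF C1 saturated_step[OF step.hyps(2)]] C2])
  then have Cp: "C \<in> parking_chains n" and CN: "C \<subseteq> NC n"
    using saturated_parking_chain[OF n] by (auto simp: saturated_def)
  have "covers_on C (dref n) y z"
    using step.hyps(2) CN unfolding good_cover_def covers_on_def C_def by blast
  then have "pchn n y z" using Cp unfolding pchn_def by blast
  moreover have "pchn n x y" using step.IH step.prems(1) y1 by blast
  ultimately show ?case unfolding pchn_def by (meson rtranclp_trans)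
qed

text \<open>Rests on the first exclusion in \<open>PE n\<close>: a block containing
  \<open>n - 1\<close> and \<open>n\<close> has a third element, so its minimum is below
  \<open>n - 1\<close>, and the bottom element separates the two.\<close>

lemma good_path_from_singletons:
  assumes n: "n \<ge> 3" and x: "x \<in> PE n"
  shows "(good_cover n)\<^sup>*\<^sup>* (singletons_partition n) x"
proof (rule good_path_of_root_free)
  show "root_free n (singletons_partition n) x"
    unfolding root_free_def
  proof
    assume "alone n (singletons_partition n) \<and> same_block x (n - 1) n"
    then have nn: "same_block x (n - 1) n" by blast
    then obtain k where k: "same_block x k n" "k \<noteq> n - 1" "k \<noteq> n" using x mem_PE_iff[OF n] by blast
    define m where "m = (LEAST j. same_block x j n)"
    have m: "same_block x m n" unfolding m_def using nn by (rule LeastI)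
    have m_le: "m \<le> j" if "same_block x j n" for j unfolding m_def using that by (rule Least_le)
    have "k \<le> n" using same_block_range(2)[OF PE_NC[OF x] k(1)] .
    then have "m < n - 1" using m_le[OF k(1)] k by simp
    then show "\<exists>m. same_block x m n \<and> (\<forall>j. same_block x j n \<longrightarrow> m \<le> j) \<and> \<not> same_block (singletons_partition n) m (n - 1)"
      using m m_le by (intro exI[of _ m]) (simp add: same_block_singletons)
  qed
qed (use n x PE_NC singletons_NC singletons_dref in auto)

text \<open>Rests on the second exclusion in \<open>PE n\<close>: the block of the top element has
  minimum 1, which \<open>x\<close> does not join to \<open>n - 1\<close> when \<open>n\<close> is
  alone.\<close>

lemma good_path_to_one_block:
  assumes n: "n \<ge> 3" and x: "x \<in> PE n"
  shows "(good_cover n)\<^sup>*\<^sup>* x (one_block_partition n)"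
proof (rule good_path_of_root_free)
  show "root_free n x (one_block_partition n)"
    unfolding root_free_def same_block_one_block
    using x n mem_PE_iff[OF n] by (intro impI exI[of _ 1]) auto
qed (use n x PE_NC one_block_NC dref_one_block in auto)

lemma pchn_iff:
  assumes n: "n \<ge> 3" and x: "x \<in> PE n" and y: "y \<in> PE n"
  shows "pchn n x y \<longleftrightarrow> dref n x y \<and> root_free n x y"
proof
  assume "pchn n x y"
  then have "(good_cover n)\<^sup>*\<^sup>* x y" using pchn_imp_good_path n by simp
  then show "dref n x y \<and> root_free n x y"
    using good_path_dref root_free_of_good_path PE_NC[OF x] n by simp
next
  assume "dref n x y \<and> root_free n x y"
  then have "(good_cover n)\<^sup>*\<^sup>* x y"
    using good_path_of_root_free[of n x y] PE_NC x y n by simp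
  then show "pchn n x y"
    using good_path_imp_pchn[of n x y] good_path_from_singletons[OF n x] good_path_to_one_block[OF n y] n by simp
qed

lemma pchn_refl: "pchn n x x"
  by (simp add: pchn_def)

lemma pchn_trans: "pchn n x y \<Longrightarrow> pchn n y z \<Longrightarrow> pchn n x z"
  unfolding pchn_def by (rule rtranclp_trans)

lemma pchn_antisym:
  assumes n: "n \<ge> 1" and xy: "pchn n x y" and yx: "pchn n y x"
  shows "x = y"
proof (cases "x \<in> NC n")
  case True
  have "y \<in> NC n" "dref n x y" using good_path_dref[OF pchn_imp_good_path[OF n xy] True] by blast+
  moreover have "dref n y x" using good_path_dref[OF pchn_imp_good_path[OF n yx]] calculation(1) by blast
  ultimately show ?thesis using dref_antisym by blast
next
  case False
  \<comment> \<open>No cover starts outside \<open>NC n\<close>, so only the empty path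
    remains.\<close>
  have "x \<notin> NC n \<Longrightarrow> x = y" 
    using pchn_imp_good_path[OF n xy]
    by (cases rule: converse_rtranclpE) (auto simp: good_cover_def covers_on_def)
  then show ?thesis using False by blast
qed

section \<open>The upper intervals\<close>

definition single_block :: "nat \<Rightarrow> nat set \<Rightarrow> nat set set" where
  "single_block n S = blocks_of n (\<lambda>i j. i = j \<or> i \<in> S \<and> j \<in> S)"

lemma single_block_NC:
  shows "single_block n S \<in> NC n"
    and "same_block (single_block n S) i j \<longleftrightarrow>
      1 \<le> i \<and> i \<le> n \<and> 1 \<le> j \<and> j \<le> n \<and> (i = j \<or> i \<in> S \<and> j \<in> S)"
  unfolding single_block_def by (rule blocks_of_NC; auto)+

text \<open>The contraction \<open>e\<close>, that is, the meet of \<open>y\<close> with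
  \<open>E\<close>. Note that \<open>n\<close> lies on the outer side, together with the numbers
  below \<open>a\<close>.\<close>

definition cut :: "nat \<Rightarrow> nat \<Rightarrow> nat set set \<Rightarrow> nat set set" where
  "cut n a y = blocks_of n (\<lambda>i j. same_block y i j \<and> (i \<in> {a..<n} \<longleftrightarrow> j \<in> {a..<n}))"

lemma cut_NC:
  assumes y: "y \<in> NC n"
  shows "cut n a y \<in> NC n"
    and "same_block (cut n a y) i j \<longleftrightarrow> same_block y i j \<and> (i \<in> {a..<n} \<longleftrightarrow> j \<in> {a..<n})"
proof -
  let ?R = "\<lambda>i j. same_block y i j \<and> (i \<in> {a..<n} \<longleftrightarrow> j \<in> {a..<n})"
  have 1: "?R i i" if "1 \<le> i" "i \<le> n" for i using same_block_refl[OF y that] by blast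
  have 2: "?R j i" if "?R i j" for i j using that same_block_sym by blast
  have 3: "?R i k" if "?R i j" "?R j k" for i j k using that same_block_trans[OF y] by blast
  have 4: "?R i j" if "1 \<le> i" "i < j" "j < k" "k < l" "l \<le> n" "?R i k" "?R j l" for i j k l
  proof
    show "same_block y i j" using noncrossing[OF y that(2-4)] that(6,7) by blast
    \<comment> \<open>Since \<open>k < l \<le> n\<close>, membership of \<open>i\<close>,
      \<open>j\<close> and \<open>k\<close> just means being at least \<open>a\<close>, so
      \<open>j\<close> agrees with \<open>i\<close> and \<open>k\<close>.\<close>
    show "i \<in> {a..<n} \<longleftrightarrow> j \<in> {a..<n}" using that by auto
  qed
  show "cut n a y \<in> NC n"
    unfolding cut_def by (rule blocks_of_NC(1)[of n ?R, OF 1 2 3 4])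
  have "same_block (cut n a y) i j \<longleftrightarrow> 1 \<le> i \<and> i \<le> n \<and> 1 \<le> j \<and> j \<le> n \<and> ?R i j"
    unfolding cut_def by (rule blocks_of_NC(2)[of n ?R, OF 1 2 3 4])
  then show "same_block (cut n a y) i j \<longleftrightarrow> ?R i j" using same_block_range[OF y] by blast
qed

lemma cut_dref: "y \<in> NC n \<Longrightarrow> dref n (cut n a y) y"
  using dref_iff[OF cut_NC(1)] cut_NC(2) by simp

lemma cut_mono:
  assumes "y \<in> NC n" "z \<in> NC n" "dref n y z"
  shows "dref n (cut n a y) (cut n a z)"
  unfolding dref_iff[OF cut_NC(1)[OF assms(1)] cut_NC(1)[OF assms(2)]]
    cut_NC(2)[OF assms(1)] cut_NC(2)[OF assms(2)]
  using same_block_mono[OF assms(3)] by blast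

lemma cut_idem: "y \<in> NC n \<Longrightarrow> cut n a (cut n a y) = cut n a y"
  by (rule NC_eqI[of _ n]) (simp_all add: cut_NC)

text \<open>The cut separates \<open>n - 1\<close> from \<open>n\<close> and, as
  \<open>2 \<le> a\<close>, from 1; this avoids both configurations excluded from
  \<open>PE n\<close>.\<close>

lemma cut_PE:
  assumes n: "n \<ge> 3" and a: "2 \<le> a" "a < n" and y: "y \<in> NC n"
  shows "cut n a y \<in> PE n" "\<not> same_block (cut n a y) (n - 1) n" "\<not> same_block (cut n a y) 1 (n - 1)"
proof -
  show 1: "\<not> same_block (cut n a y) (n - 1) n" "\<not> same_block (cut n a y) 1 (n - 1)"
    unfolding cut_NC(2)[OF y] using n a by auto
  show "cut n a y \<in> PE n" unfolding mem_PE_iff[OF n] using 1 cut_NC(1)[OF y] by blast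
qed

lemma pchn_if_separated:
  assumes "n \<ge> 3" "x \<in> PE n" "y \<in> PE n" "dref n x y" "\<not> same_block y (n - 1) n"
  shows "pchn n x y"
  using assms pchn_iff by (simp add: root_free_def)

definition upper :: "nat \<Rightarrow> nat set \<Rightarrow> nat set set set" where
  "upper n S = {y \<in> PE n. y \<noteq> one_block_partition n \<and> y \<noteq> single_block n S \<and> pchn n (single_block n S) y}"

locale block_interval =
  fixes n a :: nat and S :: "nat set"
  assumes n: "n \<ge> 3" and S: "S \<subseteq> {2..<n}" "n - 1 \<in> S" and a: "a \<in> S" and min: "\<And>s. s \<in> S \<Longrightarrow> a \<le> s"
begin

abbreviation "p \<equiv> single_block n S"

lemma a_bounds: "2 \<le> a" "a < n"
  using S(1) a by auto

lemma S_interval: "s \<in> S \<Longrightarrow> s \<in> {a..<n}"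
  using S(1) min by auto

lemma n_notin: "n \<notin> S"
  using S(1) by auto

lemma one_notin: "1 \<notin> S"
  using S(1) by auto

lemma alone_p: "alone n p"
  unfolding alone_def single_block_NC(2) using n_notin by blast

lemma p_PE: "p \<in> PE n"
proof -
  have "\<not> same_block p (n - 1) n" unfolding single_block_NC(2) using n_notin n by auto
  moreover have "\<not> same_block p 1 (n - 1)" unfolding single_block_NC(2) using one_notin n by auto
  ultimately show ?thesis unfolding mem_PE_iff[OF n] using single_block_NC(1) by blast
qed

lemma same_block_S:
  assumes "dref n p y" "s \<in> S" "t \<in> S"
  shows "same_block y s t"
proof (rule same_block_mono[OF assms(1)])
  show "same_block p s t" unfolding single_block_NC(2) using assms(2,3) S(1) by fastforce
qed

lemma p_dref_cut:
  assumes y: "y \<in> NC n" and le: "dref n p y"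
  shows "dref n p (cut n a y)"
  unfolding dref_iff[OF single_block_NC(1) cut_NC(1)[OF y]] cut_NC(2)[OF y]
proof (intro allI impI conjI)
  fix i j assume ij: "same_block p i j"
  then show "same_block y i j" by (rule same_block_mono[OF le])
  show "i \<in> {a..<n} \<longleftrightarrow> j \<in> {a..<n}" using ij S_interval unfolding single_block_NC(2) by blast
qed

lemma p_dref:
  assumes "y \<in> PE n" "pchn n p y"
  shows "dref n p y"
  using assms pchn_iff[OF n p_PE] by blast

text \<open>This is the root condition for \<open>p\<close>, in which \<open>n\<close> is alone and
  the block of \<open>n - 1\<close> is \<open>S\<close>.\<close>

lemma root_outside_S:
  assumes y: "y \<in> PE n" "pchn n p y" and "same_block y (n - 1) n"
  obtains m where "same_block y m n" "\<And>j. same_block y j n \<Longrightarrow> m \<le> j" "m \<notin> S"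
proof -
  have "root_free n p y" using y pchn_iff[OF n p_PE] by blast
  then obtain m where m: "same_block y m n" "\<forall>j. same_block y j n \<longrightarrow> m \<le> j" "\<not> same_block p m (n - 1)"
    using assms(3) alone_p unfolding root_free_def by blast
  have "m \<notin> S" using m(3) same_block_S[OF dref_refl[OF single_block_NC(1)] _ S(2)] by blast
  with m(1) show thesis using that[of m] m(2) by blast
qed

text \<open>Only the root condition needs an argument. If \<open>y\<close> joins
  \<open>n - 1\<close> to \<open>n\<close>, the minimum \<open>m\<close> of that block is outside
  \<open>S\<close>, whereas \<open>a\<close> is in the block; thus \<open>m < a\<close>, and the cut
  separates \<open>m\<close> from \<open>n - 1\<close>.\<close>

lemma cut_pchn:
  assumes y: "y \<in> PE n" "pchn n p y"
  shows "pchn n (cut n a y) y"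
proof -
  note yN = PE_NC[OF y(1)]
  have "root_free n (cut n a y) y"
    unfolding root_free_def
  proof
    assume "alone n (cut n a y) \<and> same_block y (n - 1) n"
    then have nn: "same_block y (n - 1) n" by blast
    obtain m where m: "same_block y m n" "\<And>j. same_block y j n \<Longrightarrow> m \<le> j" "m \<notin> S"
      by (rule root_outside_S[OF y nn]) (rule that)
    have "same_block y a n" using same_block_S[OF p_dref[OF y] a S(2)] nn by (rule same_block_trans[OF yN])
    then have "m < a" using m a by (metis le_neq_implies_less)
    then have "\<not> same_block (cut n a y) m (n - 1)"
      unfolding cut_NC(2)[OF yN] using a_bounds n by auto
    then show "\<exists>m. same_block y m n \<and> (\<forall>j. same_block y j n \<longrightarrow> m \<le> j) \<and> \<not> same_block (cut n a y) m (n - 1)"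
      using m(1,2) by blast
  qed
  then show ?thesis
    using pchn_iff[OF n cut_PE(1)[OF n a_bounds yN] y(1)] cut_dref[OF yN] by blast
qed

text \<open>The hypothesis says that \<open>y\<close> agrees with \<open>p\<close> within
  \<open>{a..n - 1}\<close> and within its complement. By noncrossing, \<open>y\<close> can only
  join \<open>S\<close> to outside elements, and to just one, since two would be joined to each
  other. The root condition excludes \<open>n\<close>, and membership in \<open>PE n\<close>
  excludes 1.\<close>

lemma cut_eq_p:
  assumes y: "y \<in> PE n" "pchn n p y" "y \<noteq> p" and cut: "cut n a y = p"
  obtains j where "2 \<le> j" "j < a" "y = single_block n (insert j S)"
proof -
  let ?I = "{a..<n}"
  note yN = PE_NC[OF y(1)]
  note le = p_dref[OF y(1,2)]
  note tr = same_block_trans[OF yN] and rng = same_block_range[OF yN]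
  have n1: "n - 1 \<in> ?I" "n - 1 < n" using n a_bounds by auto
  have star: "i = k \<or> i \<in> S \<and> k \<in> S" if "same_block y i k" "i \<in> ?I \<longleftrightarrow> k \<in> ?I" for i k
  proof -
    have "same_block p i k" unfolding cut[symmetric] cut_NC(2)[OF yN] using that by blast
    then show ?thesis unfolding single_block_NC(2) by blast
  qed
  have an1: "same_block y a (n - 1)" by (rule same_block_S[OF le a S(2)])
  have inI: "i \<in> S \<or> (a < i \<and> i < n - 1)" if "i \<in> ?I" for i
  proof -
    have "i = a \<or> i = n - 1 \<or> (a < i \<and> i < n - 1)" using that by auto
    then show ?thesis using a S(2) by blast
  qed
  \<comment> \<open>Otherwise \<open>n - 1\<close> and \<open>n\<close> are joined. A root outside
    \<open>{a..n - 1}\<close> would be joined to \<open>n\<close> on the same side, and a root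
    inside would be \<open>a\<close>, an element of \<open>S\<close>.\<close>
  have nI: "\<not> same_block y i n" if i: "i \<in> ?I" for i
  proof
    assume yin: "same_block y i n"
    have "i \<in> S"
    proof (rule ccontr)
      assume "i \<notin> S"
      then have "a < i" "i < n - 1" using inI[OF i] by simp_all
      then have "same_block y a i" using noncrossing[OF yN _ _ n1(2) an1 yin] by blast
      then show False using star[of a i] i a_bounds \<open>i \<notin> S\<close> \<open>a < i\<close> by auto
    qed
    then have "same_block y (n - 1) n" "same_block y a n"
      using same_block_S[OF le S(2)] same_block_S[OF le a] yin tr by blast+
    obtain m where m: "same_block y m n" "\<And>j. same_block y j n \<Longrightarrow> m \<le> j" "m \<notin> S"
      by (rule root_outside_S[OF y(1,2) \<open>same_block y (n - 1) n\<close>]) (rule that)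
    have "m \<le> n - 1" using m(2) \<open>same_block y (n - 1) n\<close> by blast
    then have "m \<noteq> n" using n by simp
    have "m \<in> ?I" using star[OF m(1)] \<open>m \<noteq> n\<close> n_notin by auto
    then have "m = a" using m(2)[OF \<open>same_block y a n\<close>] by simp
    then show False using m(3) a by blast
  qed
  have al: "alone n y"
    unfolding alone_def
  proof (intro allI impI)
    fix i assume i: "same_block y i n"
    then have "i \<notin> ?I" using nI by blast
    then show "i = n" using star[OF i] n_notin by auto
  qed
  \<comment> \<open>If \<open>k\<close> were outside \<open>S\<close>, noncrossing at
    \<open>i < a < k < n - 1\<close> would join \<open>k\<close> to \<open>a\<close> inside
    \<open>{a..n - 1}\<close>, against \<open>star\<close>.\<close>
  have mixed: "i < a \<and> k \<in> S \<and> same_block y i (n - 1)" if ik: "same_block y i k" "i \<notin> ?I" "k \<in> ?I" for i k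
  proof -
    have "i \<noteq> n" using nI[OF ik(3)] same_block_sym[OF ik(1)] by blast
    then have ia: "i < a" using ik(2) rng(2)[OF ik(1)] by auto
    have "k \<in> S"
    proof (rule ccontr)
      assume "k \<notin> S"
      then have "a < k" "k < n - 1" using inI[OF ik(3)] by simp_all
      then have "same_block y i a" using noncrossing[OF yN ia _ _ ik(1) an1] by blast
      then have "same_block y k a" using tr[OF same_block_sym[OF ik(1)]] by blast
      then show False using star[of k a] ik(3) a_bounds \<open>k \<notin> S\<close> \<open>a < k\<close> by auto
    qed
    then show ?thesis using ia tr[OF ik(1) same_block_S[OF le _ S(2)]] by blast
  qed
  obtain i k where ik: "same_block y i k" "\<not> same_block p i k"
    using NC_eqI[OF yN single_block_NC(1)] y(3) same_block_mono[OF le] by blast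
  have "\<not> (i \<in> ?I \<longleftrightarrow> k \<in> ?I)"
  proof
    assume "i \<in> ?I \<longleftrightarrow> k \<in> ?I"
    then show False using star[OF ik(1)] ik(2) rng[OF ik(1)] unfolding single_block_NC(2) by blast
  qed
  then have "\<exists>j k. same_block y j k \<and> j \<notin> ?I \<and> k \<in> ?I" using ik(1) same_block_sym by blast
  then obtain j where j: "j < a" "same_block y j (n - 1)" using mixed by blast
  \<comment> \<open>As \<open>n\<close> is alone in \<open>y\<close>, membership in
    \<open>PE n\<close> forbids joining 1 to \<open>n - 1\<close>.\<close>
  have "j \<noteq> 1" using j(2) al y(1) unfolding mem_PE_iff[OF n] by blast
  then have j2: "2 \<le> j" using rng(1)[OF j(2)] by simp
  have jn: "same_block y s (n - 1)" if "s \<in> insert j S" for s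
    using that j(2) same_block_S[OF le _ S(2)] by blast
  have "y = single_block n (insert j S)"
  proof (rule NC_eqI[OF yN single_block_NC(1)])
    fix q r
    have uniq: "i = j" if "i < a" "same_block y i (n - 1)" for i
    proof -
      have "same_block y i j" using tr[OF that(2) same_block_sym[OF j(2)]] .
      then show ?thesis using star[of i j] that(1) j(1) min[of i] by auto
    qed
    show "same_block y q r \<longleftrightarrow> same_block (single_block n (insert j S)) q r"
    proof
      assume qr: "same_block y q r"
      consider "q \<in> ?I \<longleftrightarrow> r \<in> ?I" | "q \<notin> ?I" "r \<in> ?I" | "r \<notin> ?I" "q \<in> ?I" by blast
      then have "q = r \<or> q \<in> insert j S \<and> r \<in> insert j S"
      proof cases
        case 1
        then show ?thesis using star[OF qr] by blast
      next
        case 2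
        then show ?thesis using mixed[OF qr] uniq by blast
      next
        case 3
        then show ?thesis using mixed[OF same_block_sym[OF qr]] uniq by blast
      qed
      then show "same_block (single_block n (insert j S)) q r"
        unfolding single_block_NC(2) using rng[OF qr] by blast
    next
      assume qr: "same_block (single_block n (insert j S)) q r"
      then show "same_block y q r"
        unfolding single_block_NC(2) using same_block_refl[OF yN] tr[OF jn same_block_sym[OF jn]] by blast
    qed
  qed
  then show thesis using that j2 j(1) by blast
qed

text \<open>Conical contraction by \<open>cut n a\<close>, with the cut of the top element as bound.
  Cuts separate \<open>n - 1\<close> from \<open>n\<close>, so below a cut the induced order is
  plain refinement; as \<open>cut\<close> is idempotent, it maps the remaining set into
  itself.\<close>

lemma upper_minus_nonevasive:
  "nonevasive (pchn n) (upper n S - {y \<in> upper n S. cut n a y = p})" (is "nonevasive _ ?R")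
proof -
  let ?E = "cut n a (one_block_partition n)"
  have oneN: "one_block_partition n \<in> NC n" using one_block_NC n by simp
  have not_one: "cut n a y \<noteq> one_block_partition n" if "y \<in> NC n" for y
    using cut_PE(3)[OF n a_bounds that] same_block_one_block[of n 1 "n - 1"] n by auto
  have memR: "y \<in> ?R \<longleftrightarrow> y \<in> PE n \<and> y \<noteq> one_block_partition n \<and> y \<noteq> p \<and> pchn n p y \<and> cut n a y \<noteq> p" for y
    by (auto simp: upper_def)
  have cutR: "cut n a y \<in> ?R" if y: "y \<in> NC n" "dref n p y" "cut n a y \<noteq> p" for y
  proof -
    have "pchn n p (cut n a y)"
      by (rule pchn_if_separated[OF n p_PE cut_PE(1)[OF n a_bounds y(1)] p_dref_cut[OF y(1,2)]
            cut_PE(2)[OF n a_bounds y(1)]])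
    then show ?thesis
      unfolding memR using cut_PE(1)[OF n a_bounds y(1)] not_one[OF y(1)] y(3) cut_idem[OF y(1)] by simp
  qed
  have cut_le: "pchn n (cut n a y) (cut n a z)" if "y \<in> NC n" "z \<in> NC n" "dref n y z" for y z
    by (rule pchn_if_separated[OF n cut_PE(1)[OF n a_bounds that(1)] cut_PE(1)[OF n a_bounds that(2)]
          cut_mono[OF that] cut_PE(2)[OF n a_bounds that(2)]])
  show ?thesis
  proof (rule nonevasive_conical[where E = ?E and e = "cut n a"])
    show "finite ?R"
      by (rule finite_subset[OF _ finite_NC[of n]]) (use PE_NC in \<open>auto simp: upper_def\<close>)
    show "?E \<in> ?R"
    proof (rule cutR[OF oneN])
      show "dref n p (one_block_partition n)" using dref_one_block single_block_NC(1) n by simp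
      \<comment> \<open>The pair 1, \<open>n\<close> distinguishes \<open>?E\<close> from
        \<open>p\<close>: both lie outside \<open>{a..n - 1}\<close> and outside
        \<open>S\<close>.\<close>
      have "same_block ?E 1 n" unfolding cut_NC(2)[OF oneN] same_block_one_block using n a_bounds by simp
      moreover have "\<not> same_block p 1 n" unfolding single_block_NC(2) using n n_notin by simp
      ultimately show "?E \<noteq> p" by metis
    qed
    show "pchn n x z" if "pchn n x y" "pchn n y z" for x y z using pchn_trans that by blast
    show "x = y" if "pchn n x y" "pchn n y x" for x y using pchn_antisym[OF _ that] n by simp
    fix y assume y: "y \<in> ?R"
    then have yN: "y \<in> NC n" and yP: "y \<in> PE n" "pchn n p y" and c: "cut n a y \<noteq> p"
      unfolding memR using PE_NC by blast+
    show "pchn n y y" by (rule pchn_refl)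
    show "cut n a y \<in> ?R" by (rule cutR[OF yN p_dref[OF yP] c])
    show "pchn n (cut n a y) y" by (rule cut_pchn[OF yP])
    show "pchn n (cut n a y) ?E"
      by (rule cut_le[OF yN oneN dref_one_block[OF _ yN]]) (use n in simp)
    fix z assume z: "z \<in> ?R" and yz: "pchn n y z"
    have zP: "z \<in> PE n" using z unfolding memR by blast
    have "dref n y z" using yz pchn_iff[OF n yP(1) zP] by blast
    then show "pchn n (cut n a y) (cut n a z)" by (rule cut_le[OF yN PE_NC[OF zP]])
  qed
qed

end

text \<open>Each exceptional element replaces \<open>S\<close> by \<open>insert j S\<close> with
  smaller minimum \<open>j\<close>, which drives the induction. For \<open>a = 2\<close> there are
  none, so no separate base case arises.\<close>

lemma upper_nonevasive:
  assumes "n \<ge> 3" "S \<subseteq> {2..<n}" "n - 1 \<in> S" "a \<in> S" "\<And>s. s \<in> S \<Longrightarrow> a \<le> s"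
  shows "nonevasive (pchn n) (upper n S)"
  using assms(2-)
proof (induction a arbitrary: S rule: less_induct)
  case (less a)
  interpret block_interval n a S
    by unfold_locales (use assms(1) less.prems in auto)
  define M where "M = {y \<in> upper n S. cut n a y = p}"
  have memM: "y \<in> PE n" "y \<noteq> p" "pchn n p y" "cut n a y = p" if "y \<in> M" for y
    using that by (auto simp: M_def upper_def)
  show ?case
  proof (rule nonevasive_add_minimal[where M = M])
    show "finite M"
      by (rule finite_subset[OF _ finite_NC[of n]]) (use memM(1) PE_NC in blast)
    show "M \<subseteq> upper n S" by (auto simp: M_def)
    show "nonevasive (pchn n) (upper n S - M)" unfolding M_def by (rule upper_minus_nonevasive)
    fix b assume b: "b \<in> M"
    obtain j where j: "2 \<le> j" "j < a" "b = single_block n (insert j S)"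
      by (rule cut_eq_p[OF memM(1)[OF b] memM(3)[OF b] memM(2)[OF b] memM(4)[OF b]]) (rule that)
    \<comment> \<open>An element \<open>y\<close> below \<open>b\<close> also has cut
      \<open>p\<close>, hence the single block \<open>insert i S\<close> with \<open>i < a\<close>.
      Refinement puts \<open>i\<close> into \<open>insert j S\<close>, which leaves only
      \<open>i = j\<close>.\<close>
    show "y = b" if y: "y \<in> upper n S" "pchn n y b" for y
    proof -
      have yP: "y \<in> PE n" "y \<noteq> p" "pchn n p y" using y(1) by (auto simp: upper_def)
      have yb: "dref n y b" using y(2) pchn_iff[OF n yP(1) memM(1)[OF b]] by blast
      have "dref n (cut n a y) p"
        using cut_mono[OF PE_NC[OF yP(1)] PE_NC[OF memM(1)[OF b]] yb, of a] memM(4)[OF b] by simp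
      then have "cut n a y = p"
        using p_dref_cut[OF PE_NC[OF yP(1)] p_dref[OF yP(1,3)]] dref_antisym by blast
      then obtain i where i: "2 \<le> i" "i < a" "y = single_block n (insert i S)"
        by (rule cut_eq_p[OF yP(1,3,2)]) (rule that)
      have "same_block y i (n - 1)"
        unfolding i(3) single_block_NC(2) using i S(2) a_bounds by auto
      then have "same_block b i (n - 1)" by (rule same_block_mono[OF yb])
      then have "i \<in> insert j S" unfolding j(3) single_block_NC(2) using S(2) by auto
      then have "i = j" using min[of i] i(2) by auto
      then show ?thesis using i(3) j(3) by simp
    qed
    \<comment> \<open>Whatever is above \<open>b\<close> is above \<open>p\<close>, and
      \<open>p\<close> itself is not, by antisymmetry.\<close>
    have "{y \<in> upper n S. pchn n b y \<and> y \<noteq> b} = upper n (insert j S)"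
    proof (intro equalityI subsetI)
      fix y assume "y \<in> {y \<in> upper n S. pchn n b y \<and> y \<noteq> b}"
      then show "y \<in> upper n (insert j S)" unfolding upper_def j(3)[symmetric] by blast
    next
      fix y assume "y \<in> upper n (insert j S)"
      then have y: "y \<in> PE n" "y \<noteq> one_block_partition n" "y \<noteq> b" "pchn n b y"
        unfolding upper_def j(3)[symmetric] by blast+
      have "y \<noteq> p" using pchn_antisym[of n p b] memM(2,3)[OF b] y(4) n by auto
      moreover have "pchn n p y" using pchn_trans memM(3)[OF b] y(4) by blast
      ultimately show "y \<in> {y \<in> upper n S. pchn n b y \<and> y \<noteq> b}" unfolding upper_def using y by blast
    qed
    moreover have "nonevasive (pchn n) (upper n (insert j S))"
    proof (rule less.IH[OF j(2)])
      show "insert j S \<subseteq> {2..<n}" using S(1) j a_bounds by auto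
      show "j \<le> s" if "s \<in> insert j S" for s using that j(2) min[of s] by auto
    qed (use S in auto)
    ultimately show "nonevasive (pchn n) {y \<in> upper n S. pchn n b y \<and> y \<noteq> b}" by simp
  qed
qed

theorem corollary1p2:
  fixes n :: nat
  assumes "n \<ge> 3"
  shows "topspace (geometric_realization
             (order_complex (PE n - {singletons_partition n, one_block_partition n}) (pchn n))) \<noteq> {}
       \<and> contractible_space (geometric_realization
             (order_complex (PE n - {singletons_partition n, one_block_partition n}) (pchn n)))"
proof -
  \<comment> \<open>For \<open>S = {n - 1}\<close> the block is trivial, so the upper interval is
    all of \<open>PE n\<close> without its two bounds.\<close>
  have zero: "single_block n {n - 1} = singletons_partition n"
    by (rule NC_eqI[OF single_block_NC(1) singletons_NC])
       (auto simp: single_block_NC(2) same_block_singletons)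
  have "pchn n (singletons_partition n) y" if y: "y \<in> PE n" for y
  proof (rule good_path_imp_pchn[OF _ good_path_from_singletons[OF assms y] _ good_path_to_one_block[OF assms y]])
  qed (use assms in auto)
  then have eq: "PE n - {singletons_partition n, one_block_partition n} = upper n {n - 1}"
    unfolding upper_def zero by blast
  have "nonevasive (pchn n) (upper n {n - 1})"
    by (rule upper_nonevasive[OF assms, where a = "n - 1"]) (use assms in auto)
  then show ?thesis unfolding eq by (rule nonevasive_contractible)
qed

end
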